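(* Let $G_1$ and $G_2$ be graphs. Then their Cartesian product satisfies $$\chi_{\ell}^{\bullet}(G_1 \square G_2) \leq \chi_{\ell}^{\bullet}(G_1)+\Delta(G_2)$$ and $$\chi_{c}^{\bullet}(G_1 \square G_2) \leq \chi_{c}^{\bullet}(G_1)+\Delta(G_2).$$
   Context: All graphs are finite and simple; $\Delta(G)$ is the maximum degree. The Cartesian product $A\square B$ has vertex set $V(A)\times V(B)$, with $(a_1,b_1)$ adjacent to $(a_2,b_2)$ iff either $a_1=a_2$ and $b_1b_2\in E(B)$, or $b_1=b_2$ and $a_1a_2\in E(A)$. A correspondence-cover of a graph $G$ is a pair $(L,H)$ where $H$ is a graph and $L:V(G)\to 2^{V(H)}$ satisfies: the sets $L(v)$ partition $V(H)$; each $L(v)$ induces a clique in $H$; if $uv\notin E(G)$ ($u\ne v$) there are no edges of $H$ between $L(u)$ and $L(v)$; if $uv\in E(G)$ the edges between $L(u)$ and $L(v)$ form a matching. It is $k$-fold if $|L(v)|=k$ for all $v$. A list-cover is a correspondence-cover arising from a list-assignment (each $L(v)$ a set of colours, and for each edge $uv$ the matching joins equal colours of $L(u)$ and $L(v)$). An independent transversal of $(L,H)$ is an independent set $I$ of $H$ with $|I\cap L(v)|=1$ for all $v$. The cover admits a fractional packing if there is a probability distribution on independent transversals $I$ with $\mathbb{P}(x\in I)\ge 1/|L(v)|$ for all $v$ and $x\in L(v)$. $\chi_c^{\bullet}(G)$ (resp. $\chi_\ell^{\bullet}(G)$) is the least integer $k$ such that every $k$-fold correspondence-cover (resp. list-cover)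 of $G$ admits a fractional packing. *)

theory Defs
  imports "Graph_Theory.Pair_Digraph" "HOL-Probability.Probability_Mass_Function"
begin

text \<open>
  Finite simple graphs are rendered by the locale \<^locale>\<open>pair_graph\<close>: a finite vertex set
  \<^const>\<open>pverts\<close> and a symmetric, irreflexive set \<^const>\<open>parcs\<close> of ordered pairs of vertices, so
  that an edge \<open>uv\<close> is represented by the two pairs \<open>(u, v)\<close> and \<open>(v, u)\<close>.
\<close>

definition cartesian_product ::
    "'a pair_pre_digraph \<Rightarrow> 'b pair_pre_digraph \<Rightarrow> ('a \<times> 'b) pair_pre_digraph" where
  "cartesian_product A B =
     \<lparr> pverts = pverts A \<times> pverts B,
       parcs = {((a1, b1), (a2, b2)) | a1 b1 a2 b2.
                  a1 \<in> pverts A \<and> a2 \<in> pverts A \<and> b1 \<in> pverts B \<and> b2 \<in> pverts B \<and>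
                  (a1 = a2 \<and> (b1, b2) \<in> parcs B \<or> b1 = b2 \<and> (a1, a2) \<in> parcs A)} \<rparr>"

text \<open>
  In a symmetric digraph the out-degree of a vertex is its number of neighbours.
  The inserted 0 only matters for the graph without vertices, whose maximum degree is taken to be 0.
\<close>

definition max_degree :: "'a pair_pre_digraph \<Rightarrow> nat" where
  "max_degree G = Max (insert 0 (out_degree (with_proj G) ` pverts G))"


text \<open>
  Empty parts \<open>L v\<close> are allowed in the partition of \<open>V(H)\<close>, so that a 0-fold cover of
  a graph with at least one vertex exists (it has no independent transversal).
  The arcs in \<open>L u \<times> L v\<close> form a matching iff no two of them share an endpoint in \<open>L u\<close>
  or in \<open>L v\<close>.
\<close>

definition correspondence_cover ::
    "'v pair_pre_digraph \<Rightarrow> ('v \<Rightarrow> 'h set) \<Rightarrow> 'h pair_pre_digraph \<Rightarrow> bool" where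
  "correspondence_cover G L H \<longleftrightarrow>
     pair_graph H \<and>
     (\<Union>v\<in>pverts G. L v) = pverts H \<and> disjoint_family_on L (pverts G) \<and>
     (\<forall>v\<in>pverts G. \<forall>x\<in>L v. \<forall>y\<in>L v. x \<noteq> y \<longrightarrow> (x, y) \<in> parcs H) \<and>
     (\<forall>u\<in>pverts G. \<forall>v\<in>pverts G. u \<noteq> v \<and> (u, v) \<notin> parcs G \<longrightarrow> parcs H \<inter> L u \<times> L v = {}) \<and>
     (\<forall>(u, v)\<in>parcs G.
        inj_on fst (parcs H \<inter> L u \<times> L v) \<and> inj_on snd (parcs H \<inter> L u \<times> L v))"

definition k_fold :: "nat \<Rightarrow> 'v pair_pre_digraph \<Rightarrow> ('v \<Rightarrow> 'h set) \<Rightarrow> bool" where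
  "k_fold k G L \<longleftrightarrow> (\<forall>v\<in>pverts G. card (L v) = k)"

text \<open>
  The cover arising from a list-assignment \<open>S\<close>: the copy of colour \<open>c \<in> S v\<close> belonging to the
  vertex \<open>v\<close> is the pair \<open>(v, c)\<close>.
\<close>

definition list_cover_graph ::
    "'v pair_pre_digraph \<Rightarrow> ('v \<Rightarrow> 'c set) \<Rightarrow> ('v \<times> 'c) pair_pre_digraph" where
  "list_cover_graph G S =
     \<lparr> pverts = (SIGMA v : pverts G. S v),
       parcs = {((u, c), (v, d)) | u c v d.
                  u \<in> pverts G \<and> v \<in> pverts G \<and> c \<in> S u \<and> d \<in> S v \<and>
                  (u = v \<and> c \<noteq> d \<or> (u, v) \<in> parcs G \<and> c = d)} \<rparr>"

definition list_cover ::
    "'v pair_pre_digraph \<Rightarrow> ('v \<Rightarrow> ('v \<times> 'c) set) \<Rightarrow> ('v \<times> 'c) pair_pre_digraph \<Rightarrow> bool" where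
  "list_cover G L H \<longleftrightarrow>
     correspondence_cover G L H \<and>
     (\<exists>S. (\<forall>v\<in>pverts G. L v = {v} \<times> S v) \<and> H = list_cover_graph G S)"

definition independent_transversal ::
    "'v pair_pre_digraph \<Rightarrow> ('v \<Rightarrow> 'h set) \<Rightarrow> 'h pair_pre_digraph \<Rightarrow> 'h set \<Rightarrow> bool" where
  "independent_transversal G L H I \<longleftrightarrow>
     I \<subseteq> pverts H \<and> (\<forall>x\<in>I. \<forall>y\<in>I. (x, y) \<notin> parcs H) \<and>
     (\<forall>v\<in>pverts G. card (I \<inter> L v) = 1)"

definition admits_fractional_packing ::
    "'v pair_pre_digraph \<Rightarrow> ('v \<Rightarrow> 'h set) \<Rightarrow> 'h pair_pre_digraph \<Rightarrow> bool" where
  "admits_fractional_packing G L H \<longleftrightarrow>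
     (\<exists>p :: 'h set pmf.
        set_pmf p \<subseteq> {I. independent_transversal G L H I} \<and>
        (\<forall>v\<in>pverts G. \<forall>x\<in>L v. measure_pmf.prob p {I. x \<in> I} \<ge> 1 / card (L v)))"

text \<open>
  A definition in HOL cannot quantify over the vertex type of the covering graph or over the type
  of colours, so both are fixed to be \<^typ>\<open>nat\<close>. Since covering graphs are finite, this is no
  restriction: see \<open>fractional_packing_any_cover\<close> and \<open>fractional_packing_any_list_cover\<close> below.
\<close>

definition fractional_corr_packing_number :: "'v pair_pre_digraph \<Rightarrow> nat"
    (\<open>\<chi>\<^sub>c\<^sup>\<bullet>\<close>) where
  "\<chi>\<^sub>c\<^sup>\<bullet> G =
     (LEAST k. \<forall>L (H :: nat pair_pre_digraph).
        correspondence_cover G L H \<and> k_fold k G L \<longrightarrow> admits_fractional_packing G L H)"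

definition fractional_list_packing_number :: "'v pair_pre_digraph \<Rightarrow> nat"
    (\<open>\<chi>\<^sub>l\<^sup>\<bullet>\<close>) where
  "\<chi>\<^sub>l\<^sup>\<bullet> G =
     (LEAST k. \<forall>L (H :: ('v \<times> nat) pair_pre_digraph).
        list_cover G L H \<and> k_fold k G L \<longrightarrow> admits_fractional_packing G L H)"


lemma pair_graph_cartesian_product:
  assumes "pair_graph A" "pair_graph B"
  shows "pair_graph (cartesian_product A B)"
proof -
  interpret A: pair_graph A by fact
  interpret B: pair_graph B by fact
  have fin: "finite (pverts A \<times> pverts B)"
    using A.pair_finite_verts B.pair_finite_verts by simp
  have sub: "parcs (cartesian_product A B) \<subseteq> (pverts A \<times> pverts B) \<times> (pverts A \<times> pverts B)"
    by (auto simp: cartesian_product_def)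
  have symA: "(x, y) \<in> parcs A \<Longrightarrow> (y, x) \<in> parcs A" for x y
    using A.pair_sym_arcs by (auto simp: symmetric_def elim: symE)
  have symB: "(x, y) \<in> parcs B \<Longrightarrow> (y, x) \<in> parcs B" for x y
    using B.pair_sym_arcs by (auto simp: symmetric_def elim: symE)
  show ?thesis
  proof unfold_locales
    show "finite (parcs (cartesian_product A B))"
      using finite_subset[OF sub] fin by blast
    show "symmetric (with_proj (cartesian_product A B))"
      unfolding symmetric_def
      by (rule symI) (auto simp: cartesian_product_def intro: symA symB)
    show "finite (pverts (cartesian_product A B))"
      using fin by (simp add: cartesian_product_def)
  qed (auto simp: cartesian_product_def dest: A.pair_no_loops B.pair_no_loops)
qed

definition map_graph :: "('h \<Rightarrow> 'k) \<Rightarrow> 'h pair_pre_digraph \<Rightarrow> 'k pair_pre_digraph" where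
  "map_graph f H = \<lparr> pverts = f ` pverts H, parcs = map_prod f f ` parcs H \<rparr>"

lemma correspondence_cover_map:
  assumes G: "pair_graph G" and cov: "correspondence_cover G L H" and inj: "inj_on f (pverts H)"
  shows "correspondence_cover G (\<lambda>v. f ` L v) (map_graph f H)"
proof -
  interpret G: pair_graph G by fact
  interpret H: pair_graph H using cov by (simp add: correspondence_cover_def)
  have LH: "L v \<subseteq> pverts H" if "v \<in> pverts G" for v
    using cov that by (auto simp: correspondence_cover_def)
  have arcsH: "x \<in> pverts H \<and> y \<in> pverts H" if "(x, y) \<in> parcs H" for x y
    using that H.wellformed' by blast
  have arc_iff: "(f x, f y) \<in> map_prod f f ` parcs H \<longleftrightarrow> (x, y) \<in> parcs H"
    if "x \<in> pverts H" "y \<in> pverts H" for x y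
  proof
    assume "(f x, f y) \<in> map_prod f f ` parcs H"
    then obtain x' y' where *: "(x', y') \<in> parcs H" "f x = f x'" "f y = f y'" by auto
    then have "x = x'" "y = y'" using inj_onD[OF inj] arcsH that by metis+
    with * show "(x, y) \<in> parcs H" by simp
  qed force
  have symH: "(x, y) \<in> parcs H \<Longrightarrow> (y, x) \<in> parcs H" for x y
    using H.pair_sym_arcs by (auto simp: symmetric_def elim: symE)
  have graph: "pair_graph (map_graph f H)"
  proof unfold_locales
    show "symmetric (with_proj (map_graph f H))"
      unfolding symmetric_def by (rule symI) (auto simp: map_graph_def intro!: map_prod_imageI symH)
    show "fst e \<noteq> snd e" if e: "e \<in> parcs (map_graph f H)" for e
    proof -
      obtain x y where xy: "(x, y) \<in> parcs H" "e = (f x, f y)"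
        using e by (auto simp: map_graph_def)
      then have "x \<noteq> y" using H.pair_no_loops by fastforce
      then show ?thesis using xy inj_onD[OF inj, of x y] arcsH[OF xy(1)] by auto
    qed
  qed (use H.pair_finite_verts H.pair_finite_arcs arcsH in \<open>auto simp: map_graph_def\<close>)
  have between: "parcs (map_graph f H) \<inter> f ` L u \<times> f ` L v = map_prod f f ` (parcs H \<inter> L u \<times> L v)"
    if "u \<in> pverts G" "v \<in> pverts G" for u v
  proof (intro equalityI subsetI)
    fix e assume "e \<in> parcs (map_graph f H) \<inter> f ` L u \<times> f ` L v"
    then have e: "e \<in> f ` L u \<times> f ` L v" "e \<in> map_prod f f ` parcs H"
      by (simp_all add: map_graph_def)
    obtain x y where xy: "e = (f x, f y)" "x \<in> L u" "y \<in> L v"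
      using e(1) by auto
    have "x \<in> pverts H" "y \<in> pverts H" using xy LH that by auto
    then have "(x, y) \<in> parcs H"
      using e(2) arc_iff[of x y] unfolding xy(1) by simp
    then show "e \<in> map_prod f f ` (parcs H \<inter> L u \<times> L v)"
      using xy by (auto intro!: map_prod_imageI)
  qed (auto simp: map_graph_def)
  have match: "inj_on fst (map_prod f f ` M) \<and> inj_on snd (map_prod f f ` M)"
    if "M \<subseteq> pverts H \<times> pverts H" "inj_on fst M" "inj_on snd M" for M
  proof (intro conjI inj_onI)
    fix e e' assume *: "e \<in> map_prod f f ` M" "e' \<in> map_prod f f ` M" "fst e = fst e'"
    then obtain m m' where m: "e = map_prod f f m" "e' = map_prod f f m'" "m \<in> M" "m' \<in> M" by (elim imageE)
    then have "f (fst m) = f (fst m')" "fst m \<in> pverts H" "fst m' \<in> pverts H"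
      using that(1) *(3) by auto
    then have "fst m = fst m'" using inj by (auto dest: inj_onD)
    then show "e = e'" using m that(2) by (auto dest: inj_onD)
  next
    fix e e' assume *: "e \<in> map_prod f f ` M" "e' \<in> map_prod f f ` M" "snd e = snd e'"
    then obtain m m' where m: "e = map_prod f f m" "e' = map_prod f f m'" "m \<in> M" "m' \<in> M" by (elim imageE)
    then have "f (snd m) = f (snd m')" "snd m \<in> pverts H" "snd m' \<in> pverts H"
      using that(1) *(3) by auto
    then have "snd m = snd m'" using inj by (auto dest: inj_onD)
    then show "e = e'" using m that(3) by (auto dest: inj_onD)
  qed
  have 1: "(\<Union>v\<in>pverts G. f ` L v) = pverts (map_graph f H)"
  proof -
    have "pverts H = (\<Union>v\<in>pverts G. L v)" using cov by (simp add: correspondence_cover_def)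
    then show ?thesis by (simp add: map_graph_def image_UN)
  qed
  have 2: "disjoint_family_on (\<lambda>v. f ` L v) (pverts G)"
    unfolding disjoint_family_on_def
  proof (intro ballI impI)
    fix u v assume uv: "u \<in> pverts G" "v \<in> pverts G" "u \<noteq> v"
    then have "L u \<inter> L v = {}"
      using cov by (auto simp: correspondence_cover_def disjoint_family_on_def)
    then show "f ` L u \<inter> f ` L v = {}"
      using inj_on_image_Int[OF inj LH LH, of u v] uv by simp
  qed
  have 3: "(x, y) \<in> parcs (map_graph f H)"
    if "v \<in> pverts G" "x \<in> f ` L v" "y \<in> f ` L v" "x \<noteq> y" for v x y
  proof -
    obtain a b where ab: "x = f a" "y = f b" "a \<in> L v" "b \<in> L v" "a \<noteq> b"
      using \<open>x \<in> f ` L v\<close> \<open>y \<in> f ` L v\<close> \<open>x \<noteq> y\<close> by (elim imageE) auto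
    then have "(a, b) \<in> parcs H"
      using cov \<open>v \<in> pverts G\<close> by (simp add: correspondence_cover_def)
    then show ?thesis
      using ab by (auto simp: map_graph_def intro!: map_prod_imageI)
  qed
  have 4: "parcs (map_graph f H) \<inter> f ` L u \<times> f ` L v = {}"
    if "u \<in> pverts G" "v \<in> pverts G" "u \<noteq> v" "(u, v) \<notin> parcs G" for u v
    using that cov between[of u v] by (simp add: correspondence_cover_def)
  have 5: "inj_on fst (parcs (map_graph f H) \<inter> f ` L u \<times> f ` L v) \<and>
           inj_on snd (parcs (map_graph f H) \<inter> f ` L u \<times> f ` L v)"
    if uv: "(u, v) \<in> parcs G" for u v
  proof -
    have V: "u \<in> pverts G" "v \<in> pverts G" using uv G.wellformed' by blast+
    have "inj_on fst (parcs H \<inter> L u \<times> L v)" "inj_on snd (parcs H \<inter> L u \<times> L v)"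
      using cov uv by (auto simp: correspondence_cover_def)
    moreover have "parcs H \<inter> L u \<times> L v \<subseteq> pverts H \<times> pverts H"
      using LH V by blast
    ultimately show ?thesis
      using match between[OF V] by simp
  qed
  show ?thesis
    unfolding correspondence_cover_def
  proof (intro conjI ballI impI)
    show "case e of (u, v) \<Rightarrow>
            inj_on fst (parcs (map_graph f H) \<inter> f ` L u \<times> f ` L v) \<and>
            inj_on snd (parcs (map_graph f H) \<inter> f ` L u \<times> f ` L v)"
      if "e \<in> parcs G" for e
      using that 5 by (cases e) simp
  qed (use graph 1 2 3 4 in simp_all)
qed

lemma k_fold_map:
  assumes "correspondence_cover G L H" "inj_on f (pverts H)" "k_fold k G L"
  shows "k_fold k G (\<lambda>v. f ` L v)"
  unfolding k_fold_def
proof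
  fix v assume v: "v \<in> pverts G"
  then have "L v \<subseteq> pverts H" using assms(1) by (auto simp: correspondence_cover_def)
  then show "card (f ` L v) = k"
    using assms v by (simp add: k_fold_def card_image inj_on_subset)
qed

lemma admits_fractional_packing_map:
  assumes cov: "correspondence_cover G L H" and inj: "inj_on f (pverts H)"
    and pack: "admits_fractional_packing G (\<lambda>v. f ` L v) (map_graph f H)"
  shows "admits_fractional_packing G L H"
proof -
  have LH: "L v \<subseteq> pverts H" if "v \<in> pverts G" for v
    using cov that by (auto simp: correspondence_cover_def)
  obtain p where p: "set_pmf p \<subseteq> {I. independent_transversal G (\<lambda>v. f ` L v) (map_graph f H) I}"
    "\<And>v x. v \<in> pverts G \<Longrightarrow> x \<in> f ` L v \<Longrightarrow>
       measure_pmf.prob p {I. x \<in> I} \<ge> 1 / card (f ` L v)"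
    using pack by (auto simp: admits_fractional_packing_def)
  define g where "g J = {x \<in> pverts H. f x \<in> J}" for J
  have transv: "independent_transversal G L H (g J)"
    if J: "independent_transversal G (\<lambda>v. f ` L v) (map_graph f H) J" for J
    unfolding independent_transversal_def
  proof (intro conjI ballI)
    show "g J \<subseteq> pverts H" by (auto simp: g_def)
    show "(x, y) \<notin> parcs H" if "x \<in> g J" "y \<in> g J" for x y
      using that J by (force simp: g_def independent_transversal_def map_graph_def)
    show "card (g J \<inter> L v) = 1" if v: "v \<in> pverts G" for v
    proof -
      have "J \<inter> f ` L v = f ` (g J \<inter> L v)"
        using LH[OF v] by (auto simp: g_def)
      moreover have "inj_on f (g J \<inter> L v)"
        using inj by (rule inj_on_subset) (auto simp: g_def)
      ultimately have "card (g J \<inter> L v) = card (J \<inter> f ` L v)"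
        by (simp add: card_image)
      then show ?thesis using J v by (simp add: independent_transversal_def)
    qed
  qed
  show ?thesis
    unfolding admits_fractional_packing_def
  proof (intro exI conjI ballI)
    show "set_pmf (map_pmf g p) \<subseteq> {I. independent_transversal G L H I}"
      using p(1) transv by auto
    fix v x assume v: "v \<in> pverts G" and x: "x \<in> L v"
    have "{J. x \<in> g J} = {J. f x \<in> J}"
      using LH[OF v] x by (auto simp: g_def)
    moreover have "card (f ` L v) = card (L v)"
      using inj_on_subset[OF inj LH[OF v]] by (rule card_image)
    ultimately show "measure_pmf.prob (map_pmf g p) {I. x \<in> I} \<ge> 1 / card (L v)"
      using p(2)[OF v, of "f x"] x by (simp add: vimage_def)
  qed
qed

lemma fractional_packing_any_cover:
  fixes H :: "'h pair_pre_digraph"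
  assumes "pair_graph G"
    and nat: "\<And>L' (H' :: nat pair_pre_digraph).
       correspondence_cover G L' H' \<Longrightarrow> k_fold k G L' \<Longrightarrow> admits_fractional_packing G L' H'"
    and "correspondence_cover G L H" "k_fold k G L"
  shows "admits_fractional_packing G L H"
proof -
  interpret H: pair_graph H using assms(3) by (simp add: correspondence_cover_def)
  obtain f :: "'h \<Rightarrow> nat" where inj: "inj_on f (pverts H)"
    using finite_imp_inj_to_nat_seg[OF H.pair_finite_verts] by blast
  show ?thesis
    using admits_fractional_packing_map[OF assms(3) inj]
      nat[OF correspondence_cover_map[OF assms(1,3) inj] k_fold_map[OF assms(3) inj assms(4)]]
    by blast
qed

lemma fractional_packing_any_list_cover:
  fixes G :: "'v pair_pre_digraph" and H :: "('v \<times> 'c) pair_pre_digraph"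
  assumes "pair_graph G"
    and nat: "\<And>L' (H' :: ('v \<times> nat) pair_pre_digraph).
       list_cover G L' H' \<Longrightarrow> k_fold k G L' \<Longrightarrow> admits_fractional_packing G L' H'"
    and lc: "list_cover G L H" and k: "k_fold k G L"
  shows "admits_fractional_packing G L H"
proof -
  have cov: "correspondence_cover G L H" using lc by (simp add: list_cover_def)
  interpret H: pair_graph H using cov by (simp add: correspondence_cover_def)
  obtain S where L: "\<And>v. v \<in> pverts G \<Longrightarrow> L v = {v} \<times> S v" and H: "H = list_cover_graph G S"
    using lc by (auto simp: list_cover_def)
  obtain g :: "'c \<Rightarrow> nat" where g: "inj_on g (snd ` pverts H)"
    using finite_imp_inj_to_nat_seg[of "snd ` pverts H"] H.pair_finite_verts by blast
  define f where "f = map_prod (id :: 'v \<Rightarrow> 'v) g"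
  have inj: "inj_on f (pverts H)"
    using g by (auto simp: f_def inj_on_def)
  have col: "c \<in> snd ` pverts H" if "v \<in> pverts G" "c \<in> S v" for v c
    using that by (force simp: H list_cover_graph_def)
  have geq: "g c = g d \<longleftrightarrow> c = d"
    if "u \<in> pverts G" "c \<in> S u" "v \<in> pverts G" "d \<in> S v" for u v c d
    using inj_on_eq_iff[OF g col col] that by blast
  have "map_graph f H = list_cover_graph G (\<lambda>v. g ` S v)"
  proof -
    have "pverts (map_graph f H) = (SIGMA v : pverts G. g ` S v)"
      by (force simp: map_graph_def f_def H list_cover_graph_def)
    moreover have "parcs (map_graph f H) = parcs (list_cover_graph G (\<lambda>v. g ` S v))"
    proof (intro equalityI subsetI)
      fix e assume "e \<in> parcs (map_graph f H)"
      then obtain u c v d where *: "e = ((u, g c), (v, g d))" "u \<in> pverts G" "v \<in> pverts G"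
        "c \<in> S u" "d \<in> S v" "u = v \<and> c \<noteq> d \<or> (u, v) \<in> parcs G \<and> c = d"
        by (auto simp: map_graph_def f_def H list_cover_graph_def)
      then show "e \<in> parcs (list_cover_graph G (\<lambda>v. g ` S v))"
        using geq[of u c v d] by (auto simp: list_cover_graph_def)
    next
      fix e assume "e \<in> parcs (list_cover_graph G (\<lambda>v. g ` S v))"
      then obtain u c v d where *: "e = ((u, g c), (v, g d))" "u \<in> pverts G" "v \<in> pverts G"
        "c \<in> S u" "d \<in> S v" "u = v \<and> g c \<noteq> g d \<or> (u, v) \<in> parcs G \<and> g c = g d"
        by (auto simp: list_cover_graph_def)
      then have "((u, c), (v, d)) \<in> parcs H"
        using geq[of u c v d] by (auto simp: H list_cover_graph_def)
      moreover have "e = map_prod f f ((u, c), (v, d))" using * by (simp add: f_def)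
      ultimately show "e \<in> parcs (map_graph f H)"
        unfolding map_graph_def by (metis imageI pair_pre_digraph.select_convs(2))
    qed
    ultimately show ?thesis
      by (simp add: list_cover_graph_def)
  qed
  moreover have "f ` L v = {v} \<times> g ` S v" if "v \<in> pverts G" for v
    using L[OF that] by (force simp: f_def)
  ultimately have "list_cover G (\<lambda>v. f ` L v) (map_graph f H)"
    unfolding list_cover_def
    by (intro conjI correspondence_cover_map[OF assms(1) cov inj] exI[of _ "\<lambda>v. g ` S v"]) auto
  from nat[OF this k_fold_map[OF cov inj k]] show ?thesis
    by (rule admits_fractional_packing_map[OF cov inj])
qed

text \<open>Every assignment of finite lists gives rise to a list-cover.\<close>

lemma list_cover_of_lists:
  assumes "pair_graph G" and fin: "\<And>v. v \<in> pverts G \<Longrightarrow> finite (S v)"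
  shows "list_cover G (\<lambda>v. {v} \<times> S v) (list_cover_graph G S)"
proof -
  interpret G: pair_graph G by fact
  let ?H = "list_cover_graph G S"
  have finV: "finite (pverts ?H)"
    using fin G.pair_finite_verts by (auto simp: list_cover_graph_def)
  have sub: "parcs ?H \<subseteq> pverts ?H \<times> pverts ?H"
    by (auto simp: list_cover_graph_def)
  have symG: "(x, y) \<in> parcs G \<Longrightarrow> (y, x) \<in> parcs G" for x y
    using G.pair_sym_arcs by (auto simp: symmetric_def elim: symE)
  have "pair_graph ?H"
  proof unfold_locales
    show "finite (parcs ?H)"
      using finite_subset[OF sub] finV by blast
    show "symmetric (with_proj ?H)"
      unfolding symmetric_def by (rule symI) (auto simp: list_cover_graph_def intro: symG)
  qed (use finV in \<open>auto simp: list_cover_graph_def dest: G.pair_no_loops\<close>)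
  then have "correspondence_cover G (\<lambda>v. {v} \<times> S v) ?H"
    unfolding correspondence_cover_def
    by (auto simp: list_cover_graph_def disjoint_family_on_def inj_on_def
        dest: G.pair_no_loops G.wellformed')
  then show ?thesis
    unfolding list_cover_def by blast
qed

end

theory Submission
  imports Defs "HOL-Probability.Product_PMF"
begin

text \<open>
  Write \<open>k\<close> for the packing number of \<open>G\<^sub>1\<close>. Averaging over random sublists, one may shrink the list
  of \<open>(a, v)\<close> to size \<open>k + deg v\<close>, where \<open>deg\<close> is the degree in \<open>G\<^sub>2\<close>; for lists of these sizes the claim
  is proved by induction on the number of vertices of \<open>G\<^sub>2\<close>. Let \<open>v\<close> have maximum degree and pick a
  random transversal of the copy of \<open>G\<^sub>1\<close> at \<open>v\<close>, with marginals \<open>1 / (k + deg v)\<close>. If \<open>u\<close> is a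
  neighbour of \<open>v\<close>, it forbids at most one element of the list of \<open>(a, u)\<close>, and each element is
  forbidden with probability at most \<open>1 / (k + deg v) \<le> 1 / (k + deg u)\<close>. Hence a uniformly random
  element of that list can be coupled so as to coincide with the forbidden one whenever there is one.
  Deleting it leaves a list of size \<open>k + (deg u - 1)\<close>, the right size for \<open>G\<^sub>2 - v\<close>, and the uniformity
  of the deleted element makes the final marginals uniform again.

  Taking a single vertex in place of \<open>G\<^sub>1\<close> and \<open>G\<^sub>1\<close> in place of \<open>G\<^sub>2\<close>, the same argument shows
  that the packing numbers of \<open>G\<^sub>1\<close> are at most \<open>1 + \<Delta>(G\<^sub>1)\<close>, so the least \<open>k\<close> in their definitions exists.
\<close>

section \<open>Mixtures and couplings of discrete distributions\<close>

text \<open>The law of total probability with the outcomes outside \<open>B\<close> discarded. It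
  bounds the marginals of every transversal drawn in two stages below; \<open>B\<close> is an event
  of the first stage on which the second stage is under control.\<close>

lemma prob_bind_pmf_ge:
  assumes "\<And>z. z \<in> set_pmf M \<Longrightarrow> z \<in> B \<Longrightarrow> c \<le> measure_pmf.prob (f z) S" and "0 \<le> c"
  shows "c * measure_pmf.prob M B \<le> measure_pmf.prob (bind_pmf M f) S"
proof -
  have "ennreal (c * measure_pmf.prob M B) = (\<integral>\<^sup>+z. ennreal c * indicator B z \<partial>measure_pmf M)"
    by (simp add: nn_integral_cmult_indicator measure_pmf.emeasure_eq_measure ennreal_mult' assms(2))
  also have "\<dots> \<le> (\<integral>\<^sup>+z. emeasure (measure_pmf (f z)) S \<partial>measure_pmf M)"
    by (intro nn_integral_mono_AE)
      (auto simp: AE_measure_pmf_iff measure_pmf.emeasure_eq_measure indicator_def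
        intro!: ennreal_leI assms(1))
  also have "\<dots> = ennreal (measure_pmf.prob (bind_pmf M f) S)"
    by (simp flip: measure_pmf.emeasure_eq_measure)
  finally show ?thesis by simp
qed

lemma integrable_indicator_pmf [simp]: "integrable (measure_pmf p) (indicator S :: _ \<Rightarrow> real)"
  by (rule measure_pmf.integrable_const_bound[where B = 1]) auto

text \<open>By \<open>uniq\<close>, the point of \<open>X\<close> hit by \<open>R i\<close>, if any,
  is well defined, and by \<open>le\<close> it takes each value with at most the uniform
  probability. The deficits are therefore nonnegative and add up to the probability that
  \<open>R i\<close> misses \<open>X\<close>. Drawing from the normalised deficits in the case of a
  miss restores uniformity.\<close>

lemma uniform_coupling:
  fixes P :: "'i pmf" and R :: "'i \<Rightarrow> 'x set"
  assumes X: "finite X" "X \<noteq> {}"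
    and uniq: "\<And>i x y. i \<in> set_pmf P \<Longrightarrow> x \<in> X \<inter> R i \<Longrightarrow> y \<in> X \<inter> R i \<Longrightarrow> x = y"
    and le: "\<And>x. x \<in> X \<Longrightarrow> measure_pmf.prob P {i. x \<in> R i} \<le> 1 / card X"
  obtains Z where "\<And>i. i \<in> set_pmf P \<Longrightarrow> set_pmf (Z i) \<subseteq> X"
    and "\<And>i x. i \<in> set_pmf P \<Longrightarrow> x \<in> X \<inter> R i \<Longrightarrow> Z i = return_pmf x"
    and "bind_pmf P Z = pmf_of_set X"
proof -
  define \<kappa> where "\<kappa> x = measure_pmf.prob P {i. x \<in> R i}" for x
  define N where "N = {i. X \<inter> R i = {}}"
  let ?n = "real (card X)"
  have n: "?n > 0" using X by (simp add: card_gt_0_iff)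
  \<comment> \<open>Either \<open>X\<close> is missed or exactly one of its points is hit; taking
    expectations of this identity gives \<open>total\<close>.\<close>
  have single: "(\<Sum>x\<in>X. indicator {i. x \<in> R i} i) + indicator N i = (1::real)"
    if "i \<in> set_pmf P" for i
  proof (cases "i \<in> N")
    case True
    then have "(\<Sum>x\<in>X. indicator {i. x \<in> R i} i) = (0::real)"
      by (intro sum.neutral) (auto simp: N_def indicator_def)
    with True show ?thesis by simp
  next
    case False
    then obtain x where x: "x \<in> X \<inter> R i" by (auto simp: N_def)
    have "(\<Sum>y\<in>X. indicator {i. y \<in> R i} i) = (\<Sum>y\<in>X. if y = x then 1 else (0::real))"
      using x uniq[OF that] by (intro sum.cong) (auto simp: indicator_def)
    with False x X show ?thesis by simp
  qed
  have "(\<Sum>x\<in>X. \<kappa> x) + measure_pmf.prob P N =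
      measure_pmf.expectation P (\<lambda>i. (\<Sum>x\<in>X. indicator {i. x \<in> R i} i) + indicator N i)"
    by (simp add: \<kappa>_def Bochner_Integration.integral_add Bochner_Integration.integral_sum)
  also have "\<dots> = measure_pmf.expectation P (\<lambda>i. 1)"
    by (intro integral_cong_AE) (auto simp: AE_measure_pmf_iff single)
  finally have total: "(\<Sum>x\<in>X. 1 / ?n - \<kappa> x) = measure_pmf.prob P N"
    using n by (simp add: sum_subtractf)
  have nonneg: "0 \<le> 1 / ?n - \<kappa> x" if "x \<in> X" for x
    using le[OF that] by (simp add: \<kappa>_def)
  obtain Q where Q: "set_pmf Q \<subseteq> X"
    "\<And>x. x \<in> X \<Longrightarrow> measure_pmf.prob P N * pmf Q x = 1 / ?n - \<kappa> x"
  proof (cases "measure_pmf.prob P N = 0")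
    \<comment> \<open>Misses have probability zero, so all deficits vanish and any distribution on
      \<open>X\<close> can serve as \<open>Q\<close>.\<close>
    case True
    then have "1 / ?n - \<kappa> x = 0" if "x \<in> X" for x
      using total nonneg X that by (simp add: sum_nonneg_eq_0_iff)
    with True X show ?thesis by (intro that[of "pmf_of_set X"]) auto
  next
    case False
    define q where "q x = (if x \<in> X then (1 / ?n - \<kappa> x) / measure_pmf.prob P N else 0)" for x
    have q0: "0 \<le> q x" for x
      using nonneg by (simp add: q_def)
    have "(\<Sum>x\<in>X. q x) = 1"
      using total False by (simp add: q_def flip: sum_divide_distrib)
    moreover have "(\<integral>\<^sup>+x. ennreal (q x) \<partial>count_space UNIV) = (\<Sum>x\<in>X. ennreal (q x))"
      using X by (intro nn_integral_count_space') (auto simp: q_def)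
    ultimately have q1: "(\<integral>\<^sup>+x. ennreal (q x) \<partial>count_space UNIV) = 1"
      using q0 by (simp add: sum_ennreal)
    show ?thesis
    proof (rule that[of "embed_pmf q"])
      show "set_pmf (embed_pmf q) \<subseteq> X"
        by (subst set_embed_pmf[OF q0 q1]) (auto simp: q_def)
    next
      fix x assume "x \<in> X"
      then show "measure_pmf.prob P N * pmf (embed_pmf q) x = 1 / ?n - \<kappa> x"
        using False by (simp add: pmf_embed_pmf[OF q0 q1]) (simp add: q_def)
    qed
  qed
  \<comment> \<open>\<open>Q\<close> makes up for the deficits \<open>1 / ?n - \<kappa> x\<close> on the event that \<open>R\<close> misses \<open>X\<close>.\<close>
  define Z where "Z i = (if X \<inter> R i = {} then Q else return_pmf (THE x. x \<in> X \<inter> R i))" for i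
  have Z: "Z i = return_pmf x" if "i \<in> set_pmf P" "x \<in> X \<inter> R i" for i x
  proof -
    have "(THE x. x \<in> X \<inter> R i) = x" using uniq that by (intro the_equality) blast+
    then show ?thesis using that by (auto simp: Z_def)
  qed
  have sub: "set_pmf (Z i) \<subseteq> X" if "i \<in> set_pmf P" for i
  proof (cases "X \<inter> R i = {}")
    case True
    then show ?thesis using Q by (simp add: Z_def)
  next
    case False
    then show ?thesis using Z[OF that] by auto
  qed
  have "pmf (bind_pmf P Z) x = pmf (pmf_of_set X) x" for x
  proof (cases "x \<in> X")
    case True
    have pt: "pmf (Z i) x = indicator {i. x \<in> R i} i + pmf Q x * indicator N i"
      if i: "i \<in> set_pmf P" for i
    proof (cases "X \<inter> R i = {}")
      case True
      then show ?thesis using \<open>x \<in> X\<close> by (auto simp: Z_def N_def indicator_def)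
    next
      case False
      then obtain y where y: "y \<in> X \<inter> R i" by blast
      then show ?thesis
        using Z[OF i y] uniq[OF i _ y, of x] \<open>x \<in> X\<close> by (auto simp: N_def indicator_def)
    qed
    have "pmf (bind_pmf P Z) x = measure_pmf.expectation P
        (\<lambda>i. indicator {i. x \<in> R i} i + pmf Q x * indicator N i)"
      unfolding pmf_bind by (intro integral_cong_AE) (auto simp: AE_measure_pmf_iff pt)
    also have "\<dots> = \<kappa> x + pmf Q x * measure_pmf.prob P N"
      by (simp add: \<kappa>_def)
    also have "\<dots> = 1 / ?n" using Q(2)[OF True] by (simp add: mult.commute)
    finally show ?thesis using True X by simp
  next
    case False
    then have "x \<notin> set_pmf (bind_pmf P Z)" using sub by auto
    then have "pmf (bind_pmf P Z) x = 0" unfolding set_pmf_iff by blast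
    with False X show ?thesis by simp
  qed
  then show ?thesis using that[of Z] sub Z by (blast intro: pmf_eqI)
qed

section \<open>Transversals and fractional packings over bare arc sets\<close>

text \<open>Only the arc set of the covering graph is kept, and \<open>I\<close> is confined to the
  union of the lists. Lists can then be shrunk, or restricted to some of the vertices, without
  building a new covering graph.\<close>

definition transversal :: "'v set \<Rightarrow> ('h \<times> 'h) set \<Rightarrow> ('v \<Rightarrow> 'h set) \<Rightarrow> 'h set \<Rightarrow> bool" where
  "transversal V E L I \<longleftrightarrow>
     I \<subseteq> (\<Union>v\<in>V. L v) \<and> (\<forall>x\<in>I. \<forall>y\<in>I. (x, y) \<notin> E) \<and> (\<forall>v\<in>V. card (I \<inter> L v) = 1)"

definition packable :: "'v set \<Rightarrow> ('h \<times> 'h) set \<Rightarrow> ('v \<Rightarrow> 'h set) \<Rightarrow> bool" where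
  "packable V E L \<longleftrightarrow>
     (\<exists>p. set_pmf p \<subseteq> {I. transversal V E L I} \<and>
        (\<forall>v\<in>V. \<forall>x\<in>L v. measure_pmf.prob p {I. x \<in> I} \<ge> 1 / card (L v)))"

text \<open>Only the count needs an argument: a point of \<open>I\<close> in \<open>L v\<close> lies
  in some \<open>L' u\<close>, and disjointness of the larger lists forces
  \<open>u = v\<close>.\<close>

lemma transversal_mono:
  assumes "disjoint_family_on L V" "\<And>v. v \<in> V \<Longrightarrow> L' v \<subseteq> L v" "transversal V E L' I"
  shows "transversal V E L I"
proof -
  have "I \<inter> L v = I \<inter> L' v" if v: "v \<in> V" for v
  proof (intro equalityI subsetI)
    fix x assume x: "x \<in> I \<inter> L v"
    then obtain u where u: "u \<in> V" "x \<in> L' u" using assms(3) by (auto simp: transversal_def)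
    then have "u = v" using x v assms(1,2) by (fastforce simp: disjoint_family_on_def)
    with x u show "x \<in> I \<inter> L' v" by simp
  qed (use assms(2)[OF v] in auto)
  with assms(2,3) show ?thesis unfolding transversal_def by fastforce
qed

text \<open>Linearity of expectation, since each transversal in the support meets \<open>L v\<close>
  exactly once.\<close>

lemma sum_prob_transversal:
  assumes "set_pmf p \<subseteq> {I. transversal V E L I}" "v \<in> V" "finite (L v)"
  shows "(\<Sum>x\<in>L v. measure_pmf.prob p {I. x \<in> I}) = 1"
proof -
  have one: "(\<Sum>x\<in>L v. indicator {I. x \<in> I} I) = (1::real)" if "I \<in> set_pmf p" for I
  proof -
    have "card (I \<inter> L v) = 1" using assms that by (auto simp: transversal_def)
    moreover have "(\<Sum>x\<in>L v. indicator {I. x \<in> I} I) = (\<Sum>x\<in>L v. if x \<in> I then 1 else (0::real))"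
      by (intro sum.cong) (auto simp: indicator_def)
    ultimately show ?thesis using assms(3) by (simp flip: sum.inter_restrict add: Int_commute)
  qed
  have "(\<Sum>x\<in>L v. measure_pmf.prob p {I. x \<in> I}) =
      measure_pmf.expectation p (\<lambda>I. \<Sum>x\<in>L v. indicator {I. x \<in> I} I)"
    by (subst Bochner_Integration.integral_sum) auto
  also have "\<dots> = measure_pmf.expectation p (\<lambda>I. 1)"
    by (intro integral_cong_AE) (auto simp: AE_measure_pmf_iff one)
  finally show ?thesis by simp
qed

text \<open>The lower bounds \<open>1 / card (L v)\<close> already add up to the total mass 1 of the
  marginals, which leaves no room for strict inequality.\<close>

lemma packable_prob_eq:
  assumes "packable V E L" "\<And>v. v \<in> V \<Longrightarrow> finite (L v)"
  obtains p where "set_pmf p \<subseteq> {I. transversal V E L I}"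
    and "\<And>v x. v \<in> V \<Longrightarrow> x \<in> L v \<Longrightarrow> measure_pmf.prob p {I. x \<in> I} = 1 / card (L v)"
proof -
  obtain p where p: "set_pmf p \<subseteq> {I. transversal V E L I}"
    "\<And>v x. v \<in> V \<Longrightarrow> x \<in> L v \<Longrightarrow> measure_pmf.prob p {I. x \<in> I} \<ge> 1 / card (L v)"
    using assms(1) by (auto simp: packable_def)
  have "measure_pmf.prob p {I. x \<in> I} = 1 / card (L v)" if v: "v \<in> V" and x: "x \<in> L v" for v x
  proof -
    have "card (L v) > 0" using x assms(2)[OF v] by (auto simp: card_gt_0_iff)
    then have "(\<Sum>x\<in>L v. measure_pmf.prob p {I. x \<in> I} - 1 / card (L v)) = 0"
      using sum_prob_transversal[OF p(1) v assms(2)[OF v]] by (simp add: sum_subtractf)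
    then show ?thesis
      using assms(2)[OF v] p(2)[OF v] x by (simp add: sum_nonneg_eq_0_iff)
  qed
  with p(1) that show ?thesis by blast
qed

section \<open>Shrinking lists at random\<close>

text \<open>Delete a uniformly random element of \<open>L v\<close>, where \<open>L v\<close> has
  \<open>n\<close> elements. An element survives with probability \<open>(n - 1) / n\<close> and
  then has marginal at least \<open>1 / (n - 1)\<close>, which multiplies to \<open>1 / n\<close>.
  The bound \<open>2 \<le> card (L v)\<close> keeps \<open>n - 1\<close> positive.\<close>

lemma packable_remove1:
  assumes disj: "disjoint_family_on L V" and v: "v \<in> V" and card: "2 \<le> card (L v)"
    and pack: "\<And>z. z \<in> L v \<Longrightarrow> packable V E (L(v := L v - {z}))"
  shows "packable V E L"
proof -
  have fin: "finite (L v)" using card by (intro card_ge_0_finite) simp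
  have ne: "L v \<noteq> {}" using card by auto
  define L' where "L' z = L(v := L v - {z})" for z
  have "\<exists>p. set_pmf p \<subseteq> {I. transversal V E (L' z) I} \<and>
      (\<forall>u\<in>V. \<forall>x\<in>L' z u. measure_pmf.prob p {I. x \<in> I} \<ge> 1 / card (L' z u))"
    if "z \<in> L v" for z
    using pack[OF that] by (simp add: packable_def L'_def)
  then obtain p where p: "\<And>z. z \<in> L v \<Longrightarrow> set_pmf (p z) \<subseteq> {I. transversal V E (L' z) I}"
    "\<And>z u x. z \<in> L v \<Longrightarrow> u \<in> V \<Longrightarrow> x \<in> L' z u \<Longrightarrow>
       measure_pmf.prob (p z) {I. x \<in> I} \<ge> 1 / card (L' z u)"
    by metis
  let ?U = "pmf_of_set (L v)"
  show ?thesis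
    unfolding packable_def
  proof (intro exI conjI ballI)
    have "transversal V E L I" if "z \<in> L v" "I \<in> set_pmf (p z)" for z I
      using that p(1) by (intro transversal_mono[OF disj, of "L' z"]) (auto simp: L'_def)
    then show "set_pmf (bind_pmf ?U p) \<subseteq> {I. transversal V E L I}"
      using fin ne by auto
    fix u x assume u: "u \<in> V" and x: "x \<in> L u"
    show "1 / card (L u) \<le> measure_pmf.prob (bind_pmf ?U p) {I. x \<in> I}"
    proof (cases "u = v")
      case False
      have "1 / card (L u) * measure_pmf.prob ?U UNIV
          \<le> measure_pmf.prob (bind_pmf ?U p) {I. x \<in> I}"
        using p(2)[OF _ u] x fin ne False by (intro prob_bind_pmf_ge) (auto simp: L'_def)
      then show ?thesis by simp
    next
      case True
      have "L v \<inter> - {x} = L v - {x}" by auto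
      then have B: "measure_pmf.prob ?U (- {x}) = (card (L v) - 1) / card (L v)"
        using x True fin ne by (simp add: measure_pmf_of_set)
      have "1 / (card (L v) - 1) * measure_pmf.prob ?U (- {x})
          \<le> measure_pmf.prob (bind_pmf ?U p) {I. x \<in> I}"
      proof (intro prob_bind_pmf_ge)
        fix z assume z: "z \<in> set_pmf ?U" "z \<in> - {x}"
        then have "z \<in> L v" using fin ne by simp
        moreover from this have "card (L' z v) = card (L v) - 1" using fin by (simp add: L'_def)
        ultimately show "1 / (card (L v) - 1) \<le> measure_pmf.prob (p z) {I. x \<in> I}"
          using p(2)[of z v x] v z x True by (simp add: L'_def)
      qed simp
      then show ?thesis using card True unfolding B by simp
    qed
  qed
qed

text \<open>Iterates \<open>packable_remove1\<close>, by induction on the total excess of the list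
  sizes over \<open>c\<close>. As the deletions are random, every choice of sublists of the target
  sizes has to be packable. Because \<open>c\<close> is at least 1, a list with excess has at least
  two elements.\<close>

lemma packable_shrink:
  assumes "finite V" "disjoint_family_on L V" and pos: "\<And>v. v \<in> V \<Longrightarrow> 1 \<le> c v"
    and "\<And>v. v \<in> V \<Longrightarrow> c v \<le> card (L v)"
    and "\<And>S. (\<And>v. v \<in> V \<Longrightarrow> S v \<subseteq> L v \<and> card (S v) = c v) \<Longrightarrow> packable V E S"
  shows "packable V E L"
  using assms(2,4,5)
proof (induction "\<Sum>v\<in>V. card (L v) - c v" arbitrary: L rule: less_induct)
  case less
  show ?case
  proof (cases "\<forall>v\<in>V. card (L v) = c v")
    case True
    then show ?thesis by (intro less.prems) auto
  next
    case False
    then obtain v where v: "v \<in> V" "c v < card (L v)"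
      using less.prems(2) by force
    then have fin: "finite (L v)" by (intro card_ge_0_finite) simp
    show ?thesis
    proof (rule packable_remove1[OF less.prems(1) v(1)])
      show "2 \<le> card (L v)" using v(2) pos[OF v(1)] by simp
      fix z assume z: "z \<in> L v"
      let ?L = "L(v := L v - {z})"
      have card: "card (?L u) = (if u = v then card (L v) - 1 else card (L u))" for u
        using z fin by simp
      show "packable V E ?L"
      proof (rule less.hyps)
        show "(\<Sum>u\<in>V. card (?L u) - c u) < (\<Sum>u\<in>V. card (L u) - c u)"
          using v \<open>finite V\<close> unfolding card by (intro sum_strict_mono_ex1) auto
        show "disjoint_family_on ?L V"
          using less.prems(1) by (fastforce simp: disjoint_family_on_def)
        show "c u \<le> card (?L u)" if "u \<in> V" for u
          using less.prems(2)[OF that] v(2) unfolding card by auto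
        show "packable V E S" if "\<And>u. u \<in> V \<Longrightarrow> S u \<subseteq> ?L u \<and> card (S u) = c u" for S
        proof (rule less.prems(3))
          show "S u \<subseteq> L u \<and> card (S u) = c u" if "u \<in> V" for u
            using \<open>\<And>u. u \<in> V \<Longrightarrow> S u \<subseteq> ?L u \<and> card (S u) = c u\<close>[OF that]
            by (auto split: if_splits)
        qed
      qed
    qed
  qed
qed


section \<open>Induction on the vertices of the second factor\<close>

text \<open>
  All conditions pass to sublists and to subsets of \<open>W\<close>, as the induction requires. In particular
  \<open>copy\<close> speaks about all choices of sublists of size \<open>k\<close>.
\<close>

locale product_cover =
  fixes k :: nat and A :: "'a set" and W :: "'b set" and N :: "('b \<times> 'b) set"
    and E :: "('h \<times> 'h) set" and L :: "'a \<times> 'b \<Rightarrow> 'h set"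
  assumes disjoint: "disjoint_family_on L (A \<times> W)"
    and copy: "v \<in> W \<Longrightarrow> (\<And>a. a \<in> A \<Longrightarrow> S a \<subseteq> L (a, v) \<and> card (S a) = k) \<Longrightarrow> packable A E S"
    and cross: "a \<in> A \<Longrightarrow> b \<in> A \<Longrightarrow> u \<in> W \<Longrightarrow> v \<in> W \<Longrightarrow> u \<noteq> v \<Longrightarrow> x \<in> L (a, u) \<Longrightarrow>
       y \<in> L (b, v) \<Longrightarrow> (x, y) \<in> E \<Longrightarrow> a = b \<and> (u, v) \<in> N"
    and matching: "a \<in> A \<Longrightarrow> u \<in> W \<Longrightarrow> v \<in> W \<Longrightarrow> u \<noteq> v \<Longrightarrow> x \<in> L (a, u) \<Longrightarrow>
       y \<in> L (a, v) \<Longrightarrow> y' \<in> L (a, v) \<Longrightarrow> (x, y) \<in> E \<Longrightarrow> (x, y') \<in> E \<Longrightarrow> y = y'"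

lemma product_cover_mono:
  assumes "product_cover k A W N E L" and W': "W' \<subseteq> W"
    and L': "\<And>a v. a \<in> A \<Longrightarrow> v \<in> W' \<Longrightarrow> L' (a, v) \<subseteq> L (a, v)"
  shows "product_cover k A W' N E L'"
proof -
  interpret product_cover k A W N E L by fact
  show ?thesis
  proof
    show "disjoint_family_on L' (A \<times> W')"
      unfolding disjoint_family_on_def
    proof (intro ballI impI)
      fix p q assume pq: "p \<in> A \<times> W'" "q \<in> A \<times> W'" "p \<noteq> q"
      then have "L p \<inter> L q = {}"
        using W' by (intro disjoint_family_onD[OF disjoint]) auto
      moreover have "L' p \<subseteq> L p" "L' q \<subseteq> L q" using L' pq by auto
      ultimately show "L' p \<inter> L' q = {}" by blast
    qed
    show "packable A E S"
      if "v \<in> W'" and S: "\<And>a. a \<in> A \<Longrightarrow> S a \<subseteq> L' (a, v) \<and> card (S a) = k" for v S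
    proof (rule copy)
      show "v \<in> W" using that(1) W' by blast
      show "S a \<subseteq> L (a, v) \<and> card (S a) = k" if "a \<in> A" for a
        using S[OF that] L'[OF that \<open>v \<in> W'\<close>] by blast
    qed
    show "a = b \<and> (u, v) \<in> N"
      if "a \<in> A" "b \<in> A" "u \<in> W'" "v \<in> W'" "u \<noteq> v" "x \<in> L' (a, u)" "y \<in> L' (b, v)" "(x, y) \<in> E"
      for a b u v x y
      using that L'[of a u] L'[of b v] W' cross[of a b u v x y] by blast
    show "y = y'"
      if "a \<in> A" "u \<in> W'" "v \<in> W'" "u \<noteq> v" "x \<in> L' (a, u)" "y \<in> L' (a, v)" "y' \<in> L' (a, v)"
        "(x, y) \<in> E" "(x, y') \<in> E" for a u v x y y'
      using that L'[of a u] L'[of a v] W' matching[of a u v x y y'] by blast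
  qed
qed

text \<open>Degrees are counted inside \<open>W\<close>, so the induction hypothesis for
  \<open>W - {v}\<close> asks for exactly one element fewer at each neighbour of \<open>v\<close>
  and for unchanged sizes elsewhere.\<close>

lemma packable_product:
  assumes fin: "finite A" "finite W" and k: "1 \<le> k" and symN: "sym N" and symE: "sym E"
    and "product_cover k A W N E L"
    and "\<And>a v. a \<in> A \<Longrightarrow> v \<in> W \<Longrightarrow> card (L (a, v)) = k + card {u \<in> W. (v, u) \<in> N}"
  shows "packable (A \<times> W) E L"
  using assms(2,6,7)
proof (induction "card W" arbitrary: W L rule: less_induct)
  case less
  note finW = less.prems(1)
  note card_L = less.prems(3)
  interpret product_cover k A W N E L by fact
  have fin_L: "finite (L (a, u))" if "a \<in> A" "u \<in> W" for a u
    using card_L[OF that] k by (intro card_ge_0_finite) simp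
  define deg where "deg v = card {u \<in> W. (v, u) \<in> N}" for v
  show ?case
  proof (cases "W = {}")
    case True
    then show ?thesis
      by (auto simp: packable_def transversal_def intro!: exI[of _ "return_pmf {}"])
  next
    case False
    have "Max (deg ` W) \<in> deg ` W" using False finW by simp
    then obtain v where v: "v \<in> W" "deg v = Max (deg ` W)" by auto
    have deg_max: "deg u \<le> deg v" if "u \<in> W" for u
      unfolding v(2) using finW that by simp
    have disj_v: "disjoint_family_on (\<lambda>a. L (a, v)) A"
      using disjoint v(1) by (auto simp: disjoint_family_on_def)
    \<comment> \<open>\<open>copy\<close> speaks only of lists of size exactly \<open>k\<close>,
      while these have size \<open>k + deg v\<close>; shrinking bridges the gap.\<close>
    have "packable A E (\<lambda>a. L (a, v))"
    proof (rule packable_shrink[OF fin(1) disj_v, where c = "\<lambda>_. k"])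
      show "packable A E S" if "\<And>a. a \<in> A \<Longrightarrow> S a \<subseteq> L (a, v) \<and> card (S a) = k" for S
        using copy[OF v(1)] that by blast
    qed (use k card_L v(1) in auto)
    \<comment> \<open>Exact marginals are used in both directions: as upper bounds in the coupling,
      and as lower bounds for the final marginals on the copy at \<open>v\<close>.\<close>
    then obtain P where P: "set_pmf P \<subseteq> {I. transversal A E (\<lambda>a. L (a, v)) I}"
      "\<And>a x. a \<in> A \<Longrightarrow> x \<in> L (a, v) \<Longrightarrow> measure_pmf.prob P {I. x \<in> I} = 1 / card (L (a, v))"
      using packable_prob_eq[of A E "\<lambda>a. L (a, v)"] fin_L v(1) by blast
    define W' where "W' = W - {v}"
    \<comment> \<open>\<open>Q\<close> indexes the lists that lose an element once a transversal
      \<open>I\<close> at \<open>v\<close> is chosen; \<open>R I\<close> is the set of elements that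
      \<open>I\<close> forbids.\<close>
    define Q where "Q = A \<times> {u \<in> W'. (v, u) \<in> N}"
    define R where "R I = {x. \<exists>y\<in>I. (y, x) \<in> E}" for I
    have finQ: "finite Q" using fin(1) finW by (simp add: Q_def W'_def)
    \<comment> \<open>Arcs between different copies preserve the first coordinate, so an element
      over \<open>a\<close> can be forbidden only by the single point of \<open>I\<close> in
      \<open>L (a, v)\<close>.\<close>
    have killer: "y \<in> L (a, v)" if I: "I \<in> set_pmf P" and y: "y \<in> I" "(y, x) \<in> E" and x: "x \<in> L (a, u)" "a \<in> A" "u \<in> W'"
      for I x y a u
    proof -
      obtain b where b: "b \<in> A" "y \<in> L (b, v)"
        using P(1) I y(1) unfolding transversal_def by blast
      then show ?thesis using cross[OF b(1) x(2) v(1) _ _ b(2) x(1) y(2)] x(3) by (auto simp: W'_def)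
    qed
    have "\<exists>Z. (\<forall>I\<in>set_pmf P. set_pmf (Z I) \<subseteq> L q) \<and>
        (\<forall>I\<in>set_pmf P. \<forall>x\<in>L q \<inter> R I. Z I = return_pmf x) \<and> bind_pmf P Z = pmf_of_set (L q)"
      if qQ: "q \<in> Q" for q
    proof -
      obtain a u where q: "q = (a, u)" "a \<in> A" "u \<in> W'" using qQ by (auto simp: Q_def)
      then have u: "u \<in> W" "u \<noteq> v" by (auto simp: W'_def)
      note fin_q = fin_L[OF q(2) u(1)]
      have ne: "L q \<noteq> {}" using card_L[OF q(2) u(1)] k q(1) by auto
      show ?thesis
      proof (rule uniform_coupling[of "L q" P R])
        fix I x x' assume I: "I \<in> set_pmf P" and x: "x \<in> L q \<inter> R I" and x': "x' \<in> L q \<inter> R I"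
        obtain y y' where y: "y \<in> I" "(y, x) \<in> E" and y': "y' \<in> I" "(y', x') \<in> E"
          using x x' by (auto simp: R_def)
        have "y \<in> I \<inter> L (a, v)" "y' \<in> I \<inter> L (a, v)"
          using killer[OF I] y y' x x' q by auto
        moreover have "card (I \<inter> L (a, v)) = 1"
          using P(1) I q(2) by (auto simp: transversal_def)
        then obtain w where "I \<inter> L (a, v) = {w}" by (auto simp: card_1_singleton_iff)
        ultimately have "y = y'" "y \<in> L (a, v)" by auto
        \<comment> \<open>The matching read from \<open>v\<close> to \<open>u\<close>: the one point
          of \<open>I\<close> over \<open>a\<close> forbids at most one element of
          \<open>L q\<close>.\<close>
        then show "x = x'"
          using matching[OF q(2) v(1) u(1), of y x x'] x x' y y' u(2) q(1) by auto
      next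
        fix x assume x: "x \<in> L q"
        show "measure_pmf.prob P {I. x \<in> R I} \<le> 1 / card (L q)"
        proof (cases "\<exists>y\<in>L (a, v). (y, x) \<in> E")
          case True
          then obtain y where y: "y \<in> L (a, v)" "(y, x) \<in> E" by blast
          \<comment> \<open>The matching read from \<open>u\<close> to \<open>v\<close>: only
            \<open>y\<close> can forbid \<open>x\<close>, so the event that \<open>x\<close> is
            forbidden is contained in the event that \<open>y\<close> is chosen.\<close>
          have "y \<in> I" if "I \<in> set_pmf P" "x \<in> R I" for I
          proof -
            obtain y' where y': "y' \<in> I" "(y', x) \<in> E" using \<open>x \<in> R I\<close> by (auto simp: R_def)
            have "y' \<in> L (a, v)" using killer[OF that(1) y'] x q by auto
            then have "y' = y"
              using matching[OF q(2) u(1) v(1) u(2), of x y' y] x y y' q(1) symE by (auto dest: symD)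
            then show ?thesis using y' by simp
          qed
          then have "measure_pmf.prob P {I. x \<in> R I} \<le> measure_pmf.prob P {I. y \<in> I}"
            by (intro measure_pmf.finite_measure_mono_AE) (auto simp: AE_measure_pmf_iff)
          also have "\<dots> = 1 / card (L (a, v))" using P(2) q(2) y by blast
          also have "\<dots> \<le> 1 / card (L q)"
            using card_L[OF q(2) u(1)] card_L[OF q(2) v(1)] deg_max[OF u(1)] k q(1)
            by (simp add: frac_le deg_def)
          finally show ?thesis .
        next
          case False
          then have "measure_pmf.prob P {I. x \<in> R I} = 0"
            using killer x q by (subst measure_pmf_zero_iff) (fastforce simp: R_def)
          then show ?thesis by simp
        qed
      next
        fix Z assume "\<And>I. I \<in> set_pmf P \<Longrightarrow> set_pmf (Z I) \<subseteq> L q"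
          "\<And>I x. I \<in> set_pmf P \<Longrightarrow> x \<in> L q \<inter> R I \<Longrightarrow> Z I = return_pmf x"
          "bind_pmf P Z = pmf_of_set (L q)"
        then show ?thesis by (intro exI[of _ Z]) blast
      qed (use fin_q ne q(1) in auto)
    qed
    then obtain Z where Z: "\<And>q I. q \<in> Q \<Longrightarrow> I \<in> set_pmf P \<Longrightarrow> set_pmf (Z q I) \<subseteq> L q"
      "\<And>q I x. q \<in> Q \<Longrightarrow> I \<in> set_pmf P \<Longrightarrow> x \<in> L q \<inter> R I \<Longrightarrow> Z q I = return_pmf x"
      "\<And>q. q \<in> Q \<Longrightarrow> bind_pmf P (Z q) = pmf_of_set (L q)"
      by metis
    \<comment> \<open>First \<open>I\<close> is drawn from \<open>P\<close>; given \<open>I\<close>,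
      the deleted elements \<open>z q\<close> are drawn independently from the couplings. The
      default \<open>undefined\<close> outside \<open>Q\<close> is never read, because
      \<open>L'\<close> consults \<open>z\<close> only on \<open>Q\<close>.\<close>
    define M where "M = bind_pmf P (\<lambda>I. map_pmf (Pair I) (Pi_pmf Q undefined (\<lambda>q. Z q I)))"
    define L' where "L' z q = (if q \<in> Q then L q - {z q} else L q)" for z q
    have M: "I \<in> set_pmf P" "q \<in> Q \<Longrightarrow> z q \<in> set_pmf (Z q I)" if "(I, z) \<in> set_pmf M" for I z q
      using that finQ by (cases q; auto simp: M_def set_Pi_pmf PiE_dflt_def)+
    have M_fst: "map_pmf fst M = P"
      by (simp add: M_def map_bind_pmf map_pmf_comp bind_return_pmf')
    have M_snd: "map_pmf (\<lambda>(I, z). z q) M = pmf_of_set (L q)" if "q \<in> Q" for q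
      using Z(3)[OF that] that finQ by (simp add: M_def map_bind_pmf map_pmf_comp Pi_pmf_component)
    have card_L': "card (L' z (a, u)) = k + card {w \<in> W'. (u, w) \<in> N}"
      if "(I, z) \<in> set_pmf M" "a \<in> A" "u \<in> W'" for I z a u
    proof -
      have u: "u \<in> W" using that(3) by (simp add: W'_def)
      show ?thesis
      proof (cases "(v, u) \<in> N")
        case True
        then have q: "(a, u) \<in> Q" using that by (simp add: Q_def)
        then have "z (a, u) \<in> L (a, u)" using M[OF that(1)] Z(1) by blast
        moreover have "{w \<in> W'. (u, w) \<in> N} = {w \<in> W. (u, w) \<in> N} - {v}"
          by (auto simp: W'_def)
        moreover have "v \<in> {w \<in> W. (u, w) \<in> N}" using True symN v(1) by (auto dest: symD)
        moreover from this have "card {w \<in> W. (u, w) \<in> N} > 0" using finW by (auto simp: card_gt_0_iff)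
        ultimately show ?thesis
          using q card_L[OF that(2) u] fin_L[OF that(2) u] finW by (simp add: L'_def)
      next
        case False
        then have "(u, v) \<notin> N" using symN by (auto dest: symD)
        then have "{w \<in> W'. (u, w) \<in> N} = {w \<in> W. (u, w) \<in> N}"
          by (auto simp: W'_def)
        then show ?thesis using False card_L[OF that(2) u] by (simp add: L'_def Q_def)
      qed
    qed
    have "packable (A \<times> W') E (L' z)" if "(I, z) \<in> set_pmf M" for I z
    proof (rule less.hyps)
      show "card W' < card W" unfolding W'_def using v(1) finW by (rule card_Diff1_less[rotated])
      show "finite W'" using finW by (simp add: W'_def)
      show "product_cover k A W' N E (L' z)"
        using less.prems(2) by (rule product_cover_mono) (auto simp: W'_def L'_def)
    qed (use card_L' that in blast)
    then have "\<forall>m\<in>set_pmf M. \<exists>p. set_pmf p \<subseteq> {J. transversal (A \<times> W') E (L' (snd m)) J} \<and>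
        (\<forall>q\<in>A \<times> W'. \<forall>x\<in>L' (snd m) q. measure_pmf.prob p {J. x \<in> J} \<ge> 1 / card (L' (snd m) q))"
      unfolding packable_def by (metis prod.collapse)
    then obtain p where
      p1: "\<And>m. m \<in> set_pmf M \<Longrightarrow> set_pmf (p m) \<subseteq> {J. transversal (A \<times> W') E (L' (snd m)) J}" and
      p2: "\<And>m q x. m \<in> set_pmf M \<Longrightarrow> q \<in> A \<times> W' \<Longrightarrow> x \<in> L' (snd m) q \<Longrightarrow>
         measure_pmf.prob (p m) {J. x \<in> J} \<ge> 1 / card (L' (snd m) q)"
      by (metis bchoice)
    define F where "F m = map_pmf (\<lambda>J. fst m \<union> J) (p m)" for m
    have disj': "disjoint_family_on L (A \<times> W')"
      using disjoint by (rule disjoint_family_on_mono[rotated]) (auto simp: W'_def)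
    have transv: "transversal (A \<times> W) E L (I \<union> J)"
      if m: "(I, z) \<in> set_pmf M" and J: "J \<in> set_pmf (p (I, z))" for I z J
    proof -
      have I: "transversal A E (\<lambda>a. L (a, v)) I" using M(1)[OF m] P(1) by blast
      have J': "transversal (A \<times> W') E (L' z) J" using p1[OF m] J by auto
      have JL: "transversal (A \<times> W') E L J"
        using disj' _ J' by (rule transversal_mono) (simp add: L'_def)
      \<comment> \<open>If \<open>y\<close> forbade \<open>x\<close>, then \<open>x\<close> would
        lie in \<open>R I\<close>, the coupling would be the point mass at \<open>x\<close>, and
        \<open>x\<close> would have been deleted from the list from which \<open>J\<close>
        chooses.\<close>
      have no: "(y, x) \<notin> E" if y: "y \<in> I" and x: "x \<in> J" for x y
      proof
        assume e: "(y, x) \<in> E"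
        obtain a u where au: "a \<in> A" "u \<in> W'" "x \<in> L' z (a, u)"
          using J' x unfolding transversal_def by blast
        then have xL: "x \<in> L (a, u)" by (auto simp: L'_def split: if_splits)
        have "y \<in> L (a, v)" using killer[OF M(1)[OF m] y e xL au(1,2)] .
        then have "(v, u) \<in> N"
          using cross[OF au(1) au(1) v(1) _ _ _ xL e] au(2) by (auto simp: W'_def)
        then have q: "(a, u) \<in> Q" using au by (simp add: Q_def)
        have "x \<in> L (a, u) \<inter> R I" using xL y e by (auto simp: R_def)
        then have "z (a, u) = x" using Z(2)[OF q M(1)[OF m]] M(2)[OF m q] by auto
        then show False using au(3) q by (simp add: L'_def)
      qed
      show ?thesis
        unfolding transversal_def
      proof (intro conjI ballI)
        show "I \<union> J \<subseteq> (\<Union>q\<in>A \<times> W. L q)"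
          using I JL v(1) by (fastforce simp: transversal_def W'_def)
        show "(x, y) \<notin> E" if "x \<in> I \<union> J" "y \<in> I \<union> J" for x y
          using that I JL no symE by (auto simp: transversal_def dest: symD)
        fix q assume "q \<in> A \<times> W"
        then obtain a u where q: "q = (a, u)" "a \<in> A" "u \<in> W" by auto
        show "card ((I \<union> J) \<inter> L q) = 1"
        proof (cases "u = v")
          case True
          have "L r \<inter> L q = {}" if "r \<in> A \<times> W'" for r
            using that q v(1) True by (intro disjoint_family_onD[OF disjoint]) (auto simp: W'_def)
          then have "J \<inter> L q = {}" using JL unfolding transversal_def by blast
          then show ?thesis using I q True by (simp add: transversal_def Int_Un_distrib2)
        next
          case False
          have "L (b, v) \<inter> L q = {}" if "b \<in> A" for b
            using that q v(1) False by (intro disjoint_family_onD[OF disjoint]) auto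
          then have "I \<inter> L q = {}" using I unfolding transversal_def by blast
          then show ?thesis using JL q False by (simp add: transversal_def W'_def Int_Un_distrib2)
        qed
      qed
    qed
    show ?thesis
      unfolding packable_def
    proof (intro exI conjI ballI)
      show "set_pmf (bind_pmf M F) \<subseteq> {I. transversal (A \<times> W) E L I}"
        using transv by (auto simp: F_def)
      fix q x assume "q \<in> A \<times> W" and xq: "x \<in> L q"
      then obtain a u where q: "q = (a, u)" "a \<in> A" "u \<in> W" by auto
      have F_ge: "measure_pmf.prob (p m) {J. x \<in> J} \<le> measure_pmf.prob (F m) {I. x \<in> I}" for m
        by (auto simp: F_def intro!: measure_pmf.finite_measure_mono)
      \<comment> \<open>At \<open>v\<close> the marginal is that of \<open>P\<close>. On
        \<open>Q\<close> the uniform deletion spares \<open>x\<close> with probability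
        \<open>(D - 1) / D\<close>, after which its marginal is at least \<open>1 / (D - 1)\<close>.
        Elsewhere the list is unchanged.\<close>
      consider "u = v" | "q \<in> Q" "u \<noteq> v" | "q \<notin> Q" "u \<noteq> v" by blast
      then show "1 / card (L q) \<le> measure_pmf.prob (bind_pmf M F) {I. x \<in> I}"
      proof cases
        case 1
        have "1 * measure_pmf.prob M (fst -` {I. x \<in> I}) \<le> measure_pmf.prob (bind_pmf M F) {I. x \<in> I}"
          by (intro prob_bind_pmf_ge) (auto simp: F_def vimage_def)
        also have "measure_pmf.prob M (fst -` {I. x \<in> I}) = measure_pmf.prob P {I. x \<in> I}"
          by (simp only: M_fst measure_map_pmf[symmetric])
        finally show ?thesis using P(2)[OF q(2)] xq q 1 by simp
      next
        case 2
        define D where "D = card (L q)"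
        \<comment> \<open>The vertex \<open>v\<close> contributes 1 to the degree of
          \<open>u\<close>, and \<open>k\<close> is at least 1; hence \<open>D - 1\<close> is
          nonzero and cancels at the end.\<close>
        have D: "2 \<le> D"
        proof -
          have "v \<in> {w \<in> W. (u, w) \<in> N}"
            using 2 q v(1) symN by (auto simp: Q_def dest: symD)
          then have "card {w \<in> W. (u, w) \<in> N} > 0" using finW by (auto simp: card_gt_0_iff)
          then show ?thesis using card_L[OF q(2,3)] k q(1) by (simp add: D_def)
        qed
        have fin_q: "finite (L q)" using fin_L q by simp
        have ne: "L q \<noteq> {}" using xq by auto
        have "measure_pmf.prob M ((\<lambda>(I, z). z q) -` (- {x})) = measure_pmf.prob (pmf_of_set (L q)) (- {x})"
          by (simp only: M_snd[OF 2(1)] measure_map_pmf[symmetric])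
        also have "L q \<inter> - {x} = L q - {x}" by auto
        then have "measure_pmf.prob (pmf_of_set (L q)) (- {x}) = (D - 1) / D"
          using xq fin_q ne by (simp add: measure_pmf_of_set D_def)
        finally have B: "measure_pmf.prob M ((\<lambda>(I, z). z q) -` (- {x})) = (D - 1) / D" .
        have "1 / (D - 1) * measure_pmf.prob M ((\<lambda>(I, z). z q) -` (- {x}))
            \<le> measure_pmf.prob (bind_pmf M F) {I. x \<in> I}"
        proof (intro prob_bind_pmf_ge)
          fix m assume m: "m \<in> set_pmf M" "m \<in> (\<lambda>(I, z). z q) -` (- {x})"
          obtain I z where Iz: "m = (I, z)" by (cases m)
          have "z q \<in> L q" using M m(1) Iz 2(1) Z(1) by blast
          then have "card (L' z q) = D - 1" using fin_q 2(1) by (simp add: L'_def D_def)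
          moreover have "x \<in> L' z q" using m(2) Iz xq 2(1) by (auto simp: L'_def)
          moreover have "q \<in> A \<times> W'" using 2(1) by (auto simp: Q_def)
          ultimately show "1 / (D - 1) \<le> measure_pmf.prob (F m) {I. x \<in> I}"
            using p2[OF m(1), of q x] F_ge[of m] Iz by simp
        qed simp
        then show ?thesis using D unfolding B by (simp flip: D_def)
      next
        case 3
        have "1 / card (L q) * measure_pmf.prob M UNIV \<le> measure_pmf.prob (bind_pmf M F) {I. x \<in> I}"
        proof (intro prob_bind_pmf_ge)
          fix m assume m: "m \<in> set_pmf M"
          have "q \<in> A \<times> W'" using q 3 by (simp add: W'_def)
          then show "1 / card (L q) \<le> measure_pmf.prob (F m) {I. x \<in> I}"
            using p2[OF m, of q x] F_ge[of m] xq 3(1) by (simp add: L'_def)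
        qed simp
        then show ?thesis by simp
      qed
    qed
  qed
qed


section \<open>Lists of uniform size and the maximum degree\<close>

lemma card_neighbours_le_max_degree:
  assumes "pair_graph G" "v \<in> pverts G"
  shows "card {u \<in> pverts G. (v, u) \<in> parcs G} \<le> max_degree G"
proof -
  interpret pair_graph G by fact
  have "out_arcs (with_proj G) v = Pair v ` {u \<in> pverts G. (v, u) \<in> parcs G}"
    using wellformed' by (auto simp: out_arcs_def)
  then have "card {u \<in> pverts G. (v, u) \<in> parcs G} = out_degree (with_proj G) v"
    by (simp add: out_degree_def card_image inj_on_def)
  also have "\<dots> \<le> max_degree G"
    unfolding max_degree_def using assms(2) pair_finite_verts by (intro Max_ge) auto
  finally show ?thesis .
qed

lemma pair_graph_sym:
  assumes "pair_graph G"
  shows "sym (parcs G)"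
proof -
  interpret pair_graph G by fact
  show ?thesis
    using pair_sym_arcs by (auto simp: symmetric_def)
qed

text \<open>\<open>packable_product\<close> wants sizes adapted to the individual degrees; uniform
  lists are at least that long and are shrunk to fit.\<close>

lemma packable_product_max_degree:
  fixes G :: "'b pair_pre_digraph" and A :: "'a set"
  assumes G: "pair_graph G" and "finite A" "1 \<le> k" "sym E"
    and pc: "product_cover k A (pverts G) (parcs G) E L"
    and card: "\<And>a v. a \<in> A \<Longrightarrow> v \<in> pverts G \<Longrightarrow> card (L (a, v)) = k + max_degree G"
  shows "packable (A \<times> pverts G) E L"
proof -
  interpret G: pair_graph G by fact
  interpret product_cover k A "pverts G" "parcs G" E L by fact
  define c where "c q = k + card {u \<in> pverts G. (snd q, u) \<in> parcs G}" for q :: "'a \<times> 'b"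
  show ?thesis
  proof (rule packable_shrink[OF _ disjoint, where c = c])
    show "finite (A \<times> pverts G)" using assms(2) G.pair_finite_verts by simp
    show "1 \<le> c q" for q using \<open>1 \<le> k\<close> by (simp add: c_def)
    show "c q \<le> card (L q)" if "q \<in> A \<times> pverts G" for q
      using that card card_neighbours_le_max_degree[OF G] by (auto simp: c_def)
    show "packable (A \<times> pverts G) E S"
      if S: "\<And>q. q \<in> A \<times> pverts G \<Longrightarrow> S q \<subseteq> L q \<and> card (S q) = c q" for S
    proof (rule packable_product[OF \<open>finite A\<close> G.pair_finite_verts \<open>1 \<le> k\<close> pair_graph_sym[OF G] \<open>sym E\<close>])
      show "product_cover k A (pverts G) (parcs G) E S"
        using S by (intro product_cover_mono[OF pc]) auto
    qed (use S in \<open>auto simp: c_def\<close>)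
  qed
qed

lemma admits_fractional_packing_iff_packable:
  assumes "(\<Union>v\<in>pverts G. L v) = pverts H"
  shows "admits_fractional_packing G L H \<longleftrightarrow> packable (pverts G) (parcs H) L"
  using assms
  by (simp add: admits_fractional_packing_def packable_def independent_transversal_def transversal_def)

lemma correspondence_coverD:
  assumes "correspondence_cover G L H"
  shows "pair_graph H" "(\<Union>v\<in>pverts G. L v) = pverts H" "disjoint_family_on L (pverts G)"
    and "v \<in> pverts G \<Longrightarrow> x \<in> L v \<Longrightarrow> y \<in> L v \<Longrightarrow> x \<noteq> y \<Longrightarrow> (x, y) \<in> parcs H"
    and "u \<in> pverts G \<Longrightarrow> v \<in> pverts G \<Longrightarrow> u \<noteq> v \<Longrightarrow> x \<in> L u \<Longrightarrow> y \<in> L v \<Longrightarrow>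
       (x, y) \<in> parcs H \<Longrightarrow> (u, v) \<in> parcs G"
    and "(u, v) \<in> parcs G \<Longrightarrow> inj_on fst (parcs H \<inter> L u \<times> L v)"
    and "(u, v) \<in> parcs G \<Longrightarrow> inj_on snd (parcs H \<inter> L u \<times> L v)"
proof -
  show "pair_graph H" "(\<Union>v\<in>pverts G. L v) = pverts H" "disjoint_family_on L (pverts G)"
    using assms by (simp_all add: correspondence_cover_def)
  show "(x, y) \<in> parcs H" if "v \<in> pverts G" "x \<in> L v" "y \<in> L v" "x \<noteq> y"
    using assms that by (simp add: correspondence_cover_def)
  show "(u, v) \<in> parcs G"
    if "u \<in> pverts G" "v \<in> pverts G" "u \<noteq> v" "x \<in> L u" "y \<in> L v" "(x, y) \<in> parcs H"
    using assms that unfolding correspondence_cover_def by blast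
  show "inj_on fst (parcs H \<inter> L u \<times> L v)" "inj_on snd (parcs H \<inter> L u \<times> L v)" if "(u, v) \<in> parcs G"
    using assms that by (auto simp: correspondence_cover_def)
qed

text \<open>Supplies the witness for \<open>LEAST\<close> in both packing numbers. The one-vertex
  factor is \<open>{()}\<close>, which \<open>L'\<close> ignores; on it a list of size 1 has its
  only element as a transversal, so \<open>copy\<close> holds with \<open>k = 1\<close>.\<close>

lemma admits_fractional_packing_max_degree:
  fixes G :: "'v pair_pre_digraph"
  assumes G: "pair_graph G" and cov: "correspondence_cover G L H" and "k_fold (1 + max_degree G) G L"
  shows "admits_fractional_packing G L H"
proof -
  note cov = correspondence_coverD[OF cov]
  interpret H: pair_graph H by (rule cov)
  define L' where "L' q = L (snd q)" for q :: "unit \<times> 'v"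
  have "packable ({()} \<times> pverts G) (parcs H) L'"
  proof (rule packable_product_max_degree[OF G _ _ pair_graph_sym[OF cov(1)], where k = 1])
    show "product_cover 1 {()} (pverts G) (parcs G) (parcs H) L'"
    proof
      show "disjoint_family_on L' ({()} \<times> pverts G)"
        using cov(3) by (auto simp: disjoint_family_on_def L'_def)
      show "packable {()} (parcs H) S"
        if S: "\<And>a. a \<in> {()} \<Longrightarrow> S a \<subseteq> L' (a, v) \<and> card (S a) = 1" for v S
      proof -
        obtain x where x: "S () = {x}" using S[of "()"] by (auto simp: card_1_singleton_iff)
        have "(x, x) \<notin> parcs H" using H.pair_no_loops[of "(x, x)"] by auto
        then have "transversal {()} (parcs H) S {x}" by (simp add: transversal_def x)
        then show ?thesis unfolding packable_def by (intro exI[of _ "return_pmf {x}"]) (simp add: x)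
      qed
      show "a = b \<and> (u, v) \<in> parcs G"
        if "u \<in> pverts G" "v \<in> pverts G" "u \<noteq> v" "x \<in> L' (a, u)" "y \<in> L' (b, v)" "(x, y) \<in> parcs H"
        for a b u v x y
        using that cov(5) by (simp add: L'_def)
      show "y = y'"
        if "u \<in> pverts G" "v \<in> pverts G" "u \<noteq> v" "x \<in> L' (a, u)" "y \<in> L' (a, v)" "y' \<in> L' (a, v)"
          "(x, y) \<in> parcs H" "(x, y') \<in> parcs H" for a u v x y y'
        using inj_onD[OF cov(6)[OF cov(5), of u v x y], of "(x, y)" "(x, y')"] that by (simp add: L'_def)
    qed
  qed (use assms(3) in \<open>auto simp: k_fold_def L'_def\<close>)
  moreover have "(\<Union>q\<in>{()} \<times> pverts G. L' q) = (\<Union>v\<in>pverts G. L v)"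
    by (auto simp: L'_def)
  ultimately have "packable (pverts G) (parcs H) L"
    by (simp add: packable_def transversal_def) (simp add: L'_def)
  then show ?thesis
    by (simp add: admits_fractional_packing_iff_packable[OF cov(2)])
qed

section \<open>Covers of a product restricted to one copy of the first factor\<close>

text \<open>The lists of a cover must exhaust the covering graph, so passing to sublists over one
  copy requires cutting the graph down to their union.\<close>

definition induced_graph :: "'h pair_pre_digraph \<Rightarrow> 'h set \<Rightarrow> 'h pair_pre_digraph" where
  "induced_graph H X = \<lparr> pverts = X, parcs = parcs H \<inter> X \<times> X \<rparr>"

lemma pair_graph_induced_graph:
  assumes "pair_graph H" "X \<subseteq> pverts H"
  shows "pair_graph (induced_graph H X)"
proof -
  interpret H: pair_graph H by fact
  show ?thesis
  proof unfold_locales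
    show "symmetric (with_proj (induced_graph H X))"
      using pair_graph_sym[OF assms(1)] by (auto simp: symmetric_def induced_graph_def sym_def)
    show "finite (pverts (induced_graph H X))"
      using assms(2) H.pair_finite_verts by (simp add: induced_graph_def finite_subset)
  qed (auto simp: induced_graph_def dest: H.pair_no_loops)
qed

lemma in_parcs_cartesian_product:
  "((a, u), (b, v)) \<in> parcs (cartesian_product A B) \<longleftrightarrow>
     a \<in> pverts A \<and> b \<in> pverts A \<and> u \<in> pverts B \<and> v \<in> pverts B \<and>
     (a = b \<and> (u, v) \<in> parcs B \<or> u = v \<and> (a, b) \<in> parcs A)"
  by (auto simp: cartesian_product_def)

text \<open>As \<open>G\<^sub>2\<close> has no loops, the product induces on the copy at
  \<open>v\<close> exactly the arcs of \<open>G\<^sub>1\<close>; the remaining conditions are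
  inherited by sublists.\<close>

lemma correspondence_cover_copy:
  assumes G: "pair_graph G\<^sub>1" "pair_graph G\<^sub>2"
    and cov: "correspondence_cover (cartesian_product G\<^sub>1 G\<^sub>2) L H"
    and v: "v \<in> pverts G\<^sub>2" and S: "\<And>a. a \<in> pverts G\<^sub>1 \<Longrightarrow> S a \<subseteq> L (a, v)"
  shows "correspondence_cover G\<^sub>1 S (induced_graph H (\<Union>a\<in>pverts G\<^sub>1. S a))"
proof -
  interpret G1: pair_graph G\<^sub>1 by fact
  interpret G2: pair_graph G\<^sub>2 by fact
  note cov = correspondence_coverD[OF cov]
  have V: "pverts (cartesian_product G\<^sub>1 G\<^sub>2) = pverts G\<^sub>1 \<times> pverts G\<^sub>2"
    by (simp add: cartesian_product_def)
  let ?X = "\<Union>a\<in>pverts G\<^sub>1. S a"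
  have X: "?X \<subseteq> pverts H" using S v unfolding cov(2)[symmetric] V by blast
  have arc_iff: "((a, v), (b, v)) \<in> parcs (cartesian_product G\<^sub>1 G\<^sub>2) \<longleftrightarrow> (a, b) \<in> parcs G\<^sub>1" for a b
    using v G1.wellformed' G2.pair_no_loops by (fastforce simp: in_parcs_cartesian_product)
  have sub: "parcs (induced_graph H ?X) \<inter> S a \<times> S b \<subseteq> parcs H \<inter> L (a, v) \<times> L (b, v)"
    if "a \<in> pverts G\<^sub>1" "b \<in> pverts G\<^sub>1" for a b
    using S[OF that(1)] S[OF that(2)] by (auto simp: induced_graph_def)
  show ?thesis
    unfolding correspondence_cover_def
  proof (intro conjI ballI impI)
    show "pair_graph (induced_graph H ?X)"
      using cov(1) X by (rule pair_graph_induced_graph)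
    show "?X = pverts (induced_graph H ?X)" by (simp add: induced_graph_def)
    show "disjoint_family_on S (pverts G\<^sub>1)"
      unfolding disjoint_family_on_def
    proof (intro ballI impI)
      fix a b assume ab: "a \<in> pverts G\<^sub>1" "b \<in> pverts G\<^sub>1" "a \<noteq> b"
      then have "L (a, v) \<inter> L (b, v) = {}"
        using v by (intro disjoint_family_onD[OF cov(3)]) (auto simp: V)
      then show "S a \<inter> S b = {}" using S[OF ab(1)] S[OF ab(2)] by blast
    qed
    show "(x, y) \<in> parcs (induced_graph H ?X)"
      if "a \<in> pverts G\<^sub>1" "x \<in> S a" "y \<in> S a" "x \<noteq> y" for a x y
      using that S[OF that(1)] v cov(4)[of "(a, v)" x y] by (auto simp: induced_graph_def V)
    show "parcs (induced_graph H ?X) \<inter> S a \<times> S b = {}"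
      if ab: "a \<in> pverts G\<^sub>1" "b \<in> pverts G\<^sub>1" "a \<noteq> b \<and> (a, b) \<notin> parcs G\<^sub>1" for a b
      using sub[OF ab(1,2)] ab v cov(5)[of "(a, v)" "(b, v)"] unfolding arc_iff by (fastforce simp: V)
    show "case e of (a, b) \<Rightarrow> inj_on fst (parcs (induced_graph H ?X) \<inter> S a \<times> S b) \<and>
        inj_on snd (parcs (induced_graph H ?X) \<inter> S a \<times> S b)" if "e \<in> parcs G\<^sub>1" for e
    proof -
      obtain a b where e: "e = (a, b)" by (cases e)
      with that have "(a, b) \<in> parcs G\<^sub>1" by simp
      then have "a \<in> pverts G\<^sub>1" "b \<in> pverts G\<^sub>1" "((a, v), (b, v)) \<in> parcs (cartesian_product G\<^sub>1 G\<^sub>2)"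
        using G1.wellformed' arc_iff by blast+
      then show ?thesis
        using inj_on_subset[OF cov(6) sub] inj_on_subset[OF cov(7) sub] by (simp add: e)
    qed
  qed
qed

text \<open>The common core of both inequalities. List-covers and correspondence-covers differ only
  in how \<open>copy\<close> is discharged, and \<open>copy\<close> concerns only the covers that
  arise from sublists inside one copy of \<open>G\<^sub>1\<close>.\<close>

lemma admits_fractional_packing_product:
  assumes G: "pair_graph G\<^sub>1" "pair_graph G\<^sub>2" and k: "pverts G\<^sub>1 \<noteq> {} \<Longrightarrow> 1 \<le> k"
    and cov: "correspondence_cover (cartesian_product G\<^sub>1 G\<^sub>2) L H"
    and fold: "k_fold (k + max_degree G\<^sub>2) (cartesian_product G\<^sub>1 G\<^sub>2) L"
    and copy: "\<And>v S. v \<in> pverts G\<^sub>2 \<Longrightarrow> (\<And>a. a \<in> pverts G\<^sub>1 \<Longrightarrow> S a \<subseteq> L (a, v)) \<Longrightarrow> k_fold k G\<^sub>1 S \<Longrightarrow>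
       admits_fractional_packing G\<^sub>1 S (induced_graph H (\<Union>a\<in>pverts G\<^sub>1. S a))"
  shows "admits_fractional_packing (cartesian_product G\<^sub>1 G\<^sub>2) L H"
proof -
  interpret G1: pair_graph G\<^sub>1 by fact
  note cov = correspondence_coverD[OF cov]
  have V: "pverts (cartesian_product G\<^sub>1 G\<^sub>2) = pverts G\<^sub>1 \<times> pverts G\<^sub>2"
    by (simp add: cartesian_product_def)
  have "packable (pverts G\<^sub>1 \<times> pverts G\<^sub>2) (parcs H) L"
  proof (cases "pverts G\<^sub>1 = {}")
    \<comment> \<open>For empty \<open>G\<^sub>1\<close> the value \<open>k\<close> may be 0,
      outside the range of the induction; the empty set is then a transversal.\<close>
    case True
    then show ?thesis
      by (auto simp: packable_def transversal_def intro!: exI[of _ "return_pmf {}"])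
  next
    case False
    show ?thesis
    proof (rule packable_product_max_degree[OF G(2) G1.pair_finite_verts k[OF False] pair_graph_sym[OF cov(1)]])
      show "card (L (a, v)) = k + max_degree G\<^sub>2" if "a \<in> pverts G\<^sub>1" "v \<in> pverts G\<^sub>2" for a v
        using fold that by (simp add: k_fold_def V)
      show "product_cover k (pverts G\<^sub>1) (pverts G\<^sub>2) (parcs G\<^sub>2) (parcs H) L"
      proof
        show "disjoint_family_on L (pverts G\<^sub>1 \<times> pverts G\<^sub>2)" using cov(3) by (simp add: V)
        show "packable (pverts G\<^sub>1) (parcs H) S"
          if v: "v \<in> pverts G\<^sub>2" and S: "\<And>a. a \<in> pverts G\<^sub>1 \<Longrightarrow> S a \<subseteq> L (a, v) \<and> card (S a) = k" for v S
        proof -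
          let ?X = "\<Union>a\<in>pverts G\<^sub>1. S a"
          have "admits_fractional_packing G\<^sub>1 S (induced_graph H ?X)"
            using S by (intro copy[OF v]) (auto simp: k_fold_def)
          \<comment> \<open>A transversal of \<open>S\<close> lies inside \<open>?X\<close>, where
            \<open>H\<close> and the induced graph have the same arcs.\<close>
          moreover have "transversal (pverts G\<^sub>1) (parcs (induced_graph H ?X)) S I \<longleftrightarrow>
              transversal (pverts G\<^sub>1) (parcs H) S I" for I
          proof (cases "I \<subseteq> ?X")
            case True
            then have "(x, y) \<in> parcs (induced_graph H ?X) \<longleftrightarrow> (x, y) \<in> parcs H"
              if "x \<in> I" "y \<in> I" for x y
              using that unfolding induced_graph_def by (simp; blast)
            then show ?thesis by (simp add: transversal_def)
          qed (simp add: transversal_def)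
          ultimately show ?thesis
            by (simp add: admits_fractional_packing_iff_packable induced_graph_def packable_def)
        qed
        show "a = b \<and> (u, v) \<in> parcs G\<^sub>2"
          if "a \<in> pverts G\<^sub>1" "b \<in> pverts G\<^sub>1" "u \<in> pverts G\<^sub>2" "v \<in> pverts G\<^sub>2" "u \<noteq> v"
            "x \<in> L (a, u)" "y \<in> L (b, v)" "(x, y) \<in> parcs H" for a b u v x y
          using cov(5)[of "(a, u)" "(b, v)" x y] that by (auto simp: V in_parcs_cartesian_product)
        show "y = y'"
          if "a \<in> pverts G\<^sub>1" "u \<in> pverts G\<^sub>2" "v \<in> pverts G\<^sub>2" "u \<noteq> v"
            "x \<in> L (a, u)" "y \<in> L (a, v)" "y' \<in> L (a, v)"
            "(x, y) \<in> parcs H" "(x, y') \<in> parcs H" for a u v x y y'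
          using inj_onD[OF cov(6)[OF cov(5), of "(a, u)" "(a, v)" x y], of "(x, y)" "(x, y')"] that
          by (simp add: V)
      qed
    qed
  qed
  then show ?thesis
    using cov(2) by (simp add: admits_fractional_packing_iff_packable V)
qed

text \<open>Elements over the copy have the form \<open>((a, v), c)\<close>, whereas a list-cover of
  \<open>G\<^sub>1\<close> consists of pairs \<open>(a, c)\<close>. The map \<open>f\<close> drops
  the second coordinate, which is constantly \<open>v\<close> on \<open>X\<close>, so it is
  injective there.\<close>

lemma list_cover_copy:
  fixes G\<^sub>1 :: "'a pair_pre_digraph" and G\<^sub>2 :: "'b pair_pre_digraph"
    and H :: "(('a \<times> 'b) \<times> 'c) pair_pre_digraph"
  assumes G: "pair_graph G\<^sub>1" "pair_graph G\<^sub>2"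
    and lc: "list_cover (cartesian_product G\<^sub>1 G\<^sub>2) L H"
    and v: "v \<in> pverts G\<^sub>2" and S: "\<And>a. a \<in> pverts G\<^sub>1 \<Longrightarrow> S a \<subseteq> L (a, v)"
  defines "X \<equiv> \<Union>a\<in>pverts G\<^sub>1. S a" and "f \<equiv> map_prod fst id :: ('a \<times> 'b) \<times> 'c \<Rightarrow> 'a \<times> 'c"
  shows "inj_on f X"
    and "list_cover G\<^sub>1 (\<lambda>a. f ` S a) (map_graph f (induced_graph H X))"
proof -
  interpret G1: pair_graph G\<^sub>1 by fact
  interpret G2: pair_graph G\<^sub>2 by fact
  have cov: "correspondence_cover (cartesian_product G\<^sub>1 G\<^sub>2) L H"
    using lc by (simp add: list_cover_def)
  obtain C where L: "\<And>q. q \<in> pverts G\<^sub>1 \<times> pverts G\<^sub>2 \<Longrightarrow> L q = {q} \<times> C q"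
    and H: "H = list_cover_graph (cartesian_product G\<^sub>1 G\<^sub>2) C"
    using lc by (auto simp: list_cover_def cartesian_product_def)
  \<comment> \<open>\<open>T\<close> recovers the colour lists behind \<open>S\<close>; it is the
    list-assignment that witnesses the list-cover of \<open>G\<^sub>1\<close>.\<close>
  define T where "T a = {c. ((a, v), c) \<in> S a}" for a
  have S_eq: "S a = Pair (a, v) ` T a" if "a \<in> pverts G\<^sub>1" for a
    using S[OF that] L[of "(a, v)"] that v by (auto simp: T_def)
  have X_iff: "((a, u), c) \<in> X \<longleftrightarrow> a \<in> pverts G\<^sub>1 \<and> u = v \<and> c \<in> T a" for a u c
    using S_eq by (auto simp: X_def)
  show inj: "inj_on f X"
    by (auto simp: inj_on_def f_def X_iff)
  have fS: "f ` S a = {a} \<times> T a" if "a \<in> pverts G\<^sub>1" for a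
    unfolding S_eq[OF that] by (force simp: f_def)
  have TC: "c \<in> C (a, v)" if "a \<in> pverts G\<^sub>1" "c \<in> T a" for a c
    using that S[of a] L[of "(a, v)"] v by (auto simp: T_def)
  have arc_iff: "(((a, v), c), ((b, v), d)) \<in> parcs H \<longleftrightarrow> a = b \<and> c \<noteq> d \<or> (a, b) \<in> parcs G\<^sub>1 \<and> c = d"
    if "a \<in> pverts G\<^sub>1" "c \<in> T a" "b \<in> pverts G\<^sub>1" "d \<in> T b" for a b c d
  proof -
    have "(v, v) \<notin> parcs G\<^sub>2" using G2.pair_no_loops by fastforce
    then show ?thesis
      using that TC v
      by (auto simp: H list_cover_graph_def in_parcs_cartesian_product) (auto simp: cartesian_product_def)
  qed
  have "map_graph f (induced_graph H X) = list_cover_graph G\<^sub>1 T"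
  proof -
    have "f ` X = (SIGMA a : pverts G\<^sub>1. T a)"
      using fS by (auto simp: X_def image_UN)
    moreover have "map_prod f f ` (parcs H \<inter> X \<times> X) = parcs (list_cover_graph G\<^sub>1 T)"
    proof (intro equalityI subsetI)
      fix e assume "e \<in> map_prod f f ` (parcs H \<inter> X \<times> X)"
      then obtain a u c b w d where "e = ((a, c), (b, d))" "(((a, u), c), ((b, w), d)) \<in> parcs H"
        "((a, u), c) \<in> X" "((b, w), d) \<in> X"
        by (auto simp: f_def)
      then show "e \<in> parcs (list_cover_graph G\<^sub>1 T)"
        using arc_iff[of a c b d] by (auto simp: X_iff list_cover_graph_def)
    next
      fix e assume "e \<in> parcs (list_cover_graph G\<^sub>1 T)"
      then obtain a c b d where e: "e = ((a, c), (b, d))" "a \<in> pverts G\<^sub>1" "c \<in> T a" "b \<in> pverts G\<^sub>1" "d \<in> T b"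
        "a = b \<and> c \<noteq> d \<or> (a, b) \<in> parcs G\<^sub>1 \<and> c = d"
        by (auto simp: list_cover_graph_def)
      then have "(((a, v), c), ((b, v), d)) \<in> parcs H \<inter> X \<times> X"
        using arc_iff[of a c b d] by (auto simp: X_iff)
      then have "map_prod f f (((a, v), c), ((b, v), d)) \<in> map_prod f f ` (parcs H \<inter> X \<times> X)"
        by (rule imageI)
      then show "e \<in> map_prod f f ` (parcs H \<inter> X \<times> X)" by (simp add: e(1) f_def)
    qed
    ultimately show ?thesis
      by (simp add: map_graph_def induced_graph_def list_cover_graph_def)
  qed
  moreover have "correspondence_cover G\<^sub>1 (\<lambda>a. f ` S a) (map_graph f (induced_graph H X))"
    using correspondence_cover_copy[OF G cov v S] inj
    by (intro correspondence_cover_map[OF G(1)]) (auto simp: X_def induced_graph_def)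
  ultimately show "list_cover G\<^sub>1 (\<lambda>a. f ` S a) (map_graph f (induced_graph H X))"
    using fS unfolding list_cover_def by blast
qed

text \<open>Rules out 0 as packing number of a graph with a vertex: a distribution has nonempty
  support, and a transversal in it would need a point of the empty list.\<close>

lemma not_admits_fractional_packing_empty_lists:
  assumes "v \<in> pverts G" "L v = {}"
  shows "\<not> admits_fractional_packing G L H"
proof
  assume "admits_fractional_packing G L H"
  then obtain p where "set_pmf p \<subseteq> {I. independent_transversal G L H I}"
    by (auto simp: admits_fractional_packing_def)
  moreover obtain I where "I \<in> set_pmf p" using set_pmf_not_empty[of p] by blast
  ultimately have "card (I \<inter> L v) = 1" using assms(1) by (auto simp: independent_transversal_def)
  then show False using assms(2) by simp
qed

section \<open>The two inequalities for the packing numbers\<close>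

theorem theorem2p5:
  fixes G\<^sub>1 :: "'a pair_pre_digraph" and G\<^sub>2 :: "'b pair_pre_digraph"
  assumes "pair_graph G\<^sub>1" and "pair_graph G\<^sub>2"
  shows "\<chi>\<^sub>l\<^sup>\<bullet> (cartesian_product G\<^sub>1 G\<^sub>2) \<le> \<chi>\<^sub>l\<^sup>\<bullet> G\<^sub>1 + max_degree G\<^sub>2 \<and>
         \<chi>\<^sub>c\<^sup>\<bullet> (cartesian_product G\<^sub>1 G\<^sub>2) \<le> \<chi>\<^sub>c\<^sup>\<bullet> G\<^sub>1 + max_degree G\<^sub>2"
proof
  let ?k = "\<chi>\<^sub>l\<^sup>\<bullet> G\<^sub>1"
  \<comment> \<open>The greedy-type bound \<open>1 + max_degree G\<^sub>1\<close> shows that some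
    value qualifies, so the defining property holds at the least one.\<close>
  have l: "\<forall>L (H :: ('a \<times> nat) pair_pre_digraph).
      list_cover G\<^sub>1 L H \<and> k_fold ?k G\<^sub>1 L \<longrightarrow> admits_fractional_packing G\<^sub>1 L H"
    unfolding fractional_list_packing_number_def
    by (rule LeastI[of _ "1 + max_degree G\<^sub>1"])
      (auto simp: list_cover_def intro: admits_fractional_packing_max_degree[OF assms(1)])
  \<comment> \<open>Otherwise \<open>?k\<close> is 0, and the list-cover with all lists empty would
    admit a packing.\<close>
  have pos: "1 \<le> ?k" if ne: "pverts G\<^sub>1 \<noteq> {}"
  proof (rule ccontr)
    assume "\<not> 1 \<le> ?k"
    then have k: "k_fold ?k G\<^sub>1 (\<lambda>v. {v} \<times> ({} :: nat set))" by (simp add: k_fold_def)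
    obtain v where v: "v \<in> pverts G\<^sub>1" using ne by blast
    have "list_cover G\<^sub>1 (\<lambda>v. {v} \<times> ({} :: nat set)) (list_cover_graph G\<^sub>1 (\<lambda>_. {}))"
      using list_cover_of_lists[OF assms(1), of "\<lambda>_. {}"] by simp
    from l[rule_format, OF conjI[OF this k]] show False
      using not_admits_fractional_packing_empty_lists[OF v, of "\<lambda>v. {v} \<times> ({} :: nat set)"] by simp
  qed
  show "\<chi>\<^sub>l\<^sup>\<bullet> (cartesian_product G\<^sub>1 G\<^sub>2) \<le> ?k + max_degree G\<^sub>2"
    unfolding fractional_list_packing_number_def[of "cartesian_product G\<^sub>1 G\<^sub>2"]
  proof (rule Least_le, intro allI impI, elim conjE)
    fix L and H :: "(('a \<times> 'b) \<times> nat) pair_pre_digraph"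
    assume lc: "list_cover (cartesian_product G\<^sub>1 G\<^sub>2) L H"
      and fold: "k_fold (?k + max_degree G\<^sub>2) (cartesian_product G\<^sub>1 G\<^sub>2) L"
    have cov: "correspondence_cover (cartesian_product G\<^sub>1 G\<^sub>2) L H"
      using lc unfolding list_cover_def by (rule conjunct1)
    show "admits_fractional_packing (cartesian_product G\<^sub>1 G\<^sub>2) L H"
    proof (rule admits_fractional_packing_product[OF assms pos cov fold])
      fix v S assume v: "v \<in> pverts G\<^sub>2" and S: "\<And>a. a \<in> pverts G\<^sub>1 \<Longrightarrow> S a \<subseteq> L (a, v)" and k: "k_fold ?k G\<^sub>1 S"
      let ?H = "induced_graph H (\<Union>a\<in>pverts G\<^sub>1. S a)"
      note copy = list_cover_copy[OF assms lc v S]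
      have c: "correspondence_cover G\<^sub>1 S ?H" using correspondence_cover_copy[OF assms cov v S] .
      have inj: "inj_on (map_prod fst id) (pverts ?H)" using copy(1) by (simp add: induced_graph_def)
      \<comment> \<open>After \<open>v\<close> is dropped, the restricted cover has the type that
        \<open>l\<close> speaks about; the packing is then pulled back along the injective
        projection.\<close>
      have "admits_fractional_packing G\<^sub>1 (\<lambda>a. map_prod fst id ` S a) (map_graph (map_prod fst id) ?H)"
        by (rule l[rule_format]) (intro conjI copy(2) k_fold_map[OF c inj k])
      then show "admits_fractional_packing G\<^sub>1 S ?H"
        by (rule admits_fractional_packing_map[OF c inj])
    qed
  qed
next
  let ?k = "\<chi>\<^sub>c\<^sup>\<bullet> G\<^sub>1"
  have c: "\<forall>L (H :: nat pair_pre_digraph).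
      correspondence_cover G\<^sub>1 L H \<and> k_fold ?k G\<^sub>1 L \<longrightarrow> admits_fractional_packing G\<^sub>1 L H"
    unfolding fractional_corr_packing_number_def
    by (rule LeastI[of _ "1 + max_degree G\<^sub>1"])
      (auto intro: admits_fractional_packing_max_degree[OF assms(1)])
  have pos: "1 \<le> ?k" if ne: "pverts G\<^sub>1 \<noteq> {}"
  proof (rule ccontr)
    assume "\<not> 1 \<le> ?k"
    then have k: "k_fold ?k G\<^sub>1 (\<lambda>v. {})" by (simp add: k_fold_def)
    obtain v where v: "v \<in> pverts G\<^sub>1" using ne by blast
    have "correspondence_cover G\<^sub>1 (\<lambda>v. {}) (\<lparr> pverts = {}, parcs = {} \<rparr> :: nat pair_pre_digraph)"
    proof -
      have "pair_graph (\<lparr> pverts = {}, parcs = {} \<rparr> :: nat pair_pre_digraph)"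
        by unfold_locales (auto simp: symmetric_def)
      then show ?thesis by (simp add: correspondence_cover_def disjoint_family_on_def)
    qed
    from c[rule_format, OF conjI[OF this k]] show False
      using not_admits_fractional_packing_empty_lists[OF v, of "\<lambda>_. {} :: nat set"] by simp
  qed
  show "\<chi>\<^sub>c\<^sup>\<bullet> (cartesian_product G\<^sub>1 G\<^sub>2) \<le> ?k + max_degree G\<^sub>2"
    unfolding fractional_corr_packing_number_def[of "cartesian_product G\<^sub>1 G\<^sub>2"]
  proof (rule Least_le, intro allI impI, elim conjE)
    fix L and H :: "nat pair_pre_digraph"
    assume cov: "correspondence_cover (cartesian_product G\<^sub>1 G\<^sub>2) L H"
      and fold: "k_fold (?k + max_degree G\<^sub>2) (cartesian_product G\<^sub>1 G\<^sub>2) L"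
    show "admits_fractional_packing (cartesian_product G\<^sub>1 G\<^sub>2) L H"
    proof (rule admits_fractional_packing_product[OF assms pos cov fold])
      fix v S assume v: "v \<in> pverts G\<^sub>2" and S: "\<And>a. a \<in> pverts G\<^sub>1 \<Longrightarrow> S a \<subseteq> L (a, v)" and k: "k_fold ?k G\<^sub>1 S"
      \<comment> \<open>The elements of the cover already have type \<open>nat\<close>, so
        \<open>c\<close> applies to the restricted cover without relabelling.\<close>
      show "admits_fractional_packing G\<^sub>1 S (induced_graph H (\<Union>a\<in>pverts G\<^sub>1. S a))"
        by (rule c[rule_format, OF conjI[OF correspondence_cover_copy[OF assms cov v S] k]])
    qed
  qed
qed

end
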